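(* Let $n\in\mathbb N$, let $u,v$ be weights on $\mathbb R^+=(0,\infty)$, let $a_0,\dots,a_n$ be measurable functions on $\mathbb R^+$, and let $$(\mathcal A f)(x)=\int_0^x\Big[\sum_{k=0}^n a_k(x)t^k\Big]f(t)\,dt .$$ Let $u^{-2}\in B_\delta$ for some $\delta\ge 0$. If $\delta>0$, assume in addition that $a_kv\in L_2(0,r)$ for all $r>0$ and $k=0,\dots,n-1$. Then there exists a constant $C>0$ such that $$\|v\,\mathcal A f\|_{L_2(\mathbb R^+)}\le C\,\|uf\|_{L_2(\mathbb R^+)}\quad\text{for all } f \text{ with } \|uf\|_{L_2(\mathbb R^+)}<\infty$$ if and only if $$S_k=\sup_{r>0}\ \|a_kv\|_{L_2(r,\infty)}\cdot\|x^ku^{-1}\|_{L_2(0,r)}<\infty,\qquad k=0,\dots,n.$$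
   Context: A weight is a nonnegative measurable function on $\mathbb R^+=(0,\infty)$. For $\delta\ge0$, $B_\delta$ denotes the set of positive locally summable functions $w$ on $\mathbb R^+$ for which there is a constant $D(w)$ such that $$\int_\Delta w(x)\,dx\le D(w)\int_{\frac12\Delta}w(x)\,dx$$ for every (bounded, nondegenerate) interval $\Delta\subset\mathbb R^+$ of length $|\Delta|\ge\delta$, where $\frac12\Delta$ is the interval of length $\frac12|\Delta|$ with the same center as $\Delta$. *)

theory Defs
  imports "HOL-Analysis.Analysis"
begin

text \<open>
  Functions on the positive half-line are total functions of type \<open>real \<Rightarrow> real\<close>; only their
  values on \<open>{0<..}\<close> matter.
\<close>

definition weight :: "(real \<Rightarrow> real) \<Rightarrow> bool" where
  "weight w \<longleftrightarrow> w \<in> borel_measurable (lebesgue_on {0<..}) \<and> (\<forall>x>0. 0 \<le> w x)"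

text \<open>The extended-valued norm is infinite exactly when the square is not integrable.\<close>

definition L2norm :: "real set \<Rightarrow> (real \<Rightarrow> real) \<Rightarrow> ennreal" where
  "L2norm E g =
     (let I = (\<integral>\<^sup>+ x. ennreal ((g x)\<^sup>2) \<partial>lebesgue_on E)
      in if I = \<infinity> then \<infinity> else ennreal (sqrt (enn2real I)))"

text \<open>
  Endpoints of an interval are irrelevant to the integrals, so the intervals are the \<open>{a<..<b}\<close> with
  \<open>0 \<le> a < b\<close>; those with \<open>a = 0\<close> are included. The concentric interval of half the length is
  \<open>{(3 * a + b) / 4<..<(a + 3 * b) / 4}\<close>. Local summability refers to compact subsets of
  \<open>{0<..}\<close>. Positivity is meant almost everywhere: where \<open>u x = 0\<close>, the
  function \<open>inverse ((u x)\<^sup>2)\<close> takes the value \<open>0\<close> instead of infinity, and this is harmless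
  on a null set.
\<close>

definition B :: "real \<Rightarrow> (real \<Rightarrow> real) set" where
  "B \<delta> = {w.
     (AE x in lebesgue_on {0<..}. 0 < w x) \<and>
     (\<forall>K. compact K \<and> K \<subseteq> {0<..} \<longrightarrow> integrable (lebesgue_on K) w) \<and>
     (\<exists>D::real. \<forall>a b. 0 \<le> a \<and> a < b \<and> \<delta> \<le> b - a \<longrightarrow>
        (\<integral>\<^sup>+ x. ennreal (w x) \<partial>lebesgue_on {a<..<b})
        \<le> ennreal D *
          (\<integral>\<^sup>+ x. ennreal (w x) \<partial>lebesgue_on {(3 * a + b) / 4<..<(a + 3 * b) / 4}))}"

definition poly_op :: "nat \<Rightarrow> (nat \<Rightarrow> real \<Rightarrow> real) \<Rightarrow> (real \<Rightarrow> real) \<Rightarrow> real \<Rightarrow> real" where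
  "poly_op n a f x = (\<integral> t. (\<Sum>k\<le>n. a k x * t ^ k) * f t \<partial>lebesgue_on {0<..<x})"

definition S :: "(nat \<Rightarrow> real \<Rightarrow> real) \<Rightarrow> (real \<Rightarrow> real) \<Rightarrow> (real \<Rightarrow> real) \<Rightarrow> nat \<Rightarrow> ennreal" where
  "S a u v k =
     (SUP r\<in>{0<..}. L2norm {r<..} (\<lambda>x. a k x * v x) * L2norm {0<..<r} (\<lambda>x. x ^ k * inverse (u x)))"

end

theory Submission
  imports Defs
begin

text \<open>
  Sufficiency: since \<open>\<A> f\<close> is the sum of the \<open>a k x * \<integral>\<^sub>0\<^sup>x t ^ k * f t\<close>, it is enough to apply Muckenhoupt's
  weighted Hardy inequality to each term.

  Necessity: for \<open>f\<close> supported in \<open>(0, r)\<close> and \<open>x > r\<close>, the value of \<open>\<A> f x\<close> is the integral of \<open>f\<close> against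
  a polynomial with coefficients \<open>a k x\<close>. If \<open>r\<close> is large compared with \<open>\<delta>\<close>, the doubling property of
  \<open>w = 1 / u\<^sup>2\<close> allows to recover each coefficient from \<open>n + 1\<close> test functions whose norms are controlled by
  the mass of \<open>(0, r)\<close>. The remaining small \<open>r\<close>, which exist only for \<open>\<delta> > 0\<close>, are handled by the
  additional integrability assumption on \<open>a 0 v, \<dots>, a (n - 1) v\<close>.
\<close>

section \<open>Integrals on the half-line\<close>

text \<open>Necessity cannot be read off term by term: the summands of \<open>poly_op\<close> may
  cancel, so a bound for the operator says nothing about a single \<open>a k\<close> until
  \<open>n + 1\<close> independent tests are combined. Indicators of intervals times
  \<open>w\<close> suit this purpose because their squared norm and their integral are the same
  number, the mass of the interval. A test therefore costs the reciprocal of that mass, and doubling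
  keeps it comparable with the reciprocal of the mass of (0, r). The node at which a test evaluates
  the polynomial varies with x, so the interpolation constant must be uniform in the nodes. For
  small r the intervals are too short for doubling and a single test has to do; it isolates only the
  coefficient of index n, which is why the extra assumption covers the others. The weight
  \<open>w\<close> is only locally summable in the open half-line. Its summability up to 0 comes
  from doubling itself, applied to (0, R), whose concentric half stays away from 0; this makes all
  moments of f over (0, x) converge absolutely.\<close>

abbreviation half_line :: "real measure" where
  "half_line \<equiv> lebesgue_on {0<..}"

lemma measurable_ident_half_line [measurable]: "(\<lambda>x. x) \<in> borel_measurable half_line"
  by (intro measurable_restrict_space1 measurable_completion) simp

lemma indicator_half_line_measurable [measurable]:
  "A \<in> sets borel \<Longrightarrow> indicator A \<in> borel_measurable half_line"
  by (rule measurable_compose[OF measurable_ident_half_line borel_measurable_indicator])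

lemma nn_integral_lebesgue_on_half_line:
  fixes f :: "real \<Rightarrow> ennreal"
  assumes "E \<in> sets borel" "E \<subseteq> {0<..}"
  shows "(\<integral>\<^sup>+x. f x \<partial>lebesgue_on E) = (\<integral>\<^sup>+x\<in>E. f x \<partial>half_line)"
proof -
  have E: "E \<in> sets lebesgue" using assms by auto
  have "lebesgue_on E = restrict_space half_line E"
    using assms by (subst restrict_restrict_space) (auto simp: E Int_absorb1)
  then show ?thesis
    by (simp only:) (rule nn_integral_restrict_space,
      use assms E in \<open>auto simp: sets_restrict_space intro!: image_eqI[of _ _ E]\<close>)
qed

lemma L2norm_power2: "L2norm E g ^ 2 = (\<integral>\<^sup>+x. ennreal ((g x)\<^sup>2) \<partial>lebesgue_on E)"
proof (cases "(\<integral>\<^sup>+x. ennreal ((g x)\<^sup>2) \<partial>lebesgue_on E)")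
  case (real q)
  then show ?thesis by (simp add: L2norm_def ennreal_power)
qed (simp add: L2norm_def)

lemma ennreal_power2_le_iff: "x\<^sup>2 \<le> y\<^sup>2 \<longleftrightarrow> x \<le> y" for x y :: ennreal
proof
  assume "x\<^sup>2 \<le> y\<^sup>2"
  show "x \<le> y"
  proof (rule ccontr)
    assume "\<not> x \<le> y"
    then have "y < x" by simp
    then obtain c where "y = ennreal c" "0 \<le> c" by (cases y) auto
    with \<open>y < x\<close> \<open>x\<^sup>2 \<le> y\<^sup>2\<close> show False
      by (cases x) (auto simp: ennreal_power ennreal_less_iff top_unique)
  qed
qed (rule power_mono_ennreal)

lemma ennreal_power2_less_top_iff: "x\<^sup>2 < top \<longleftrightarrow> x < top" for x :: ennreal
  by (auto simp: power2_eq_square ennreal_mult_less_top)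

lemma AE_half_line_neq: "AE x in half_line. x \<noteq> c"
proof -
  have "AE x in lebesgue. x \<noteq> c"
    by (rule AE_completion) (rule AE_lborel_singleton)
  then show ?thesis by (subst AE_restrict_space_iff) auto
qed

lemma nn_integral_half_line_split:
  fixes f :: "real \<Rightarrow> ennreal"
  assumes [measurable]: "f \<in> borel_measurable half_line" and "a < b" "b < c"
  shows "(\<integral>\<^sup>+x\<in>{a<..<c}. f x \<partial>half_line)
    = (\<integral>\<^sup>+x\<in>{a<..<b}. f x \<partial>half_line) + (\<integral>\<^sup>+x\<in>{b<..<c}. f x \<partial>half_line)"
proof -
  have "(\<integral>\<^sup>+x\<in>{a<..<c}. f x \<partial>half_line)
    = (\<integral>\<^sup>+x. f x * indicator {a<..<b} x + f x * indicator {b<..<c} x \<partial>half_line)"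
    using AE_half_line_neq[of b] assms(2,3)
    by (intro nn_integral_cong_AE) (auto simp: indicator_def)
  then show ?thesis by (simp add: nn_integral_add)
qed

text \<open>The primitive is continuous and vanishes at 0, so the intermediate value theorem yields
  every level up to \<open>T\<close>. This supplies the cut points for halving a primitive.\<close>

lemma half_line_primitive_attains:
  fixes h :: "real \<Rightarrow> real"
  assumes [measurable]: "h \<in> borel_measurable half_line"
    and nn: "\<And>x. 0 \<le> h x" and "0 < R"
    and R: "(\<integral>\<^sup>+t\<in>{0<..<R}. ennreal (h t) \<partial>half_line) = ennreal T" and c: "0 < c" "c \<le> T"
  shows "\<exists>y. 0 < y \<and> y \<le> R \<and> (\<integral>\<^sup>+t\<in>{0<..<y}. ennreal (h t) \<partial>half_line) = ennreal c"
proof -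
  \<comment> \<open>Extended by 0 outside (0, R), so that closed intervals starting at 0 can serve
    as domains and the continuity of indefinite integrals applies.\<close>
  define h0 where "h0 t = indicator {0<..} t * (h t * indicator {0<..<R} t)" for t
  have h0_meas: "h0 \<in> borel_measurable lebesgue"
  proof -
    have "(\<lambda>t. h t * indicator {0<..<R} t) \<in> borel_measurable half_line" by measurable
    then show ?thesis
      unfolding h0_def by (subst (asm) borel_measurable_restrict_space_iff) (auto simp: mult.commute)
  qed
  have h0nn: "0 \<le> h0 x" for x using nn[of x] by (auto simp: h0_def indicator_def)
  have eq: "(\<integral>\<^sup>+t. ennreal (h0 t) \<partial>lebesgue_on {0..y}) = (\<integral>\<^sup>+t\<in>{0<..<y}. ennreal (h t) \<partial>half_line)"
    if "0 \<le> y" "y \<le> R" for y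
  proof -
    have "AE x in lebesgue. x \<noteq> y"
      by (rule AE_completion) (rule AE_lborel_singleton)
    then have "(\<integral>\<^sup>+t. ennreal (h0 t) * indicator {0..y} t \<partial>lebesgue)
      = (\<integral>\<^sup>+t. ennreal (h t) * indicator {0<..<y} t * indicator {0<..} t \<partial>lebesgue)"
      using that by (intro nn_integral_cong_AE) (auto simp: h0_def indicator_def)
    then show ?thesis by (simp add: nn_integral_restrict_space)
  qed
  have "integrable (lebesgue_on {0..R}) h0"
    using eq[of R] h0_meas \<open>0 < R\<close> R h0nn by (intro integrableI_nonneg) (auto simp: measurable_restrict_space1)
  then have cont: "continuous_on {0..R} (\<lambda>x. integral\<^sup>L (lebesgue_on {0..x}) h0)"
    by (rule indefinite_integral_continuous_real)
  have int: "integral\<^sup>L (lebesgue_on {0..x}) h0 = enn2real (\<integral>\<^sup>+t\<in>{0<..<x}. ennreal (h t) \<partial>half_line)"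
    if "0 \<le> x" "x \<le> R" for x
    using that h0_meas h0nn by (subst integral_eq_nn_integral) (auto simp: eq measurable_restrict_space1)
  have "\<exists>y\<ge>0. y \<le> R \<and> integral\<^sup>L (lebesgue_on {0..y}) h0 = c"
    using cont \<open>0 < R\<close> c by (intro IVT') (simp_all only: int, auto simp: R)
  then obtain y where y: "0 \<le> y" "y \<le> R" "enn2real (\<integral>\<^sup>+t\<in>{0<..<y}. ennreal (h t) \<partial>half_line) = c"
    using int by auto
  moreover have "y \<noteq> 0" using y c by auto
  moreover have "(\<integral>\<^sup>+t\<in>{0<..<y}. ennreal (h t) \<partial>half_line) = ennreal c"
    using y(3) c by (cases "\<integral>\<^sup>+t\<in>{0<..<y}. ennreal (h t) \<partial>half_line") auto
  ultimately show ?thesis by (intro exI[of _ y]) auto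
qed

lemma integral_lebesgue_on_half_line:
  fixes f :: "real \<Rightarrow> real"
  assumes "E \<in> sets borel" "E \<subseteq> {0<..}"
  shows "(LINT x|lebesgue_on E. f x) = (LINT x|half_line. indicator E x * f x)"
    and "integrable (lebesgue_on E) f \<longleftrightarrow> integrable half_line (\<lambda>x. indicator E x * f x)"
proof -
  have E: "E \<inter> space half_line \<in> sets half_line"
    using assms by (auto simp: sets_restrict_space intro!: image_eqI[of _ _ E])
  have "lebesgue_on E = restrict_space half_line E"
    using assms by (subst restrict_restrict_space) (auto simp: Int_absorb1)
  then show "(LINT x|lebesgue_on E. f x) = (LINT x|half_line. indicator E x * f x)"
    and "integrable (lebesgue_on E) f \<longleftrightarrow> integrable half_line (\<lambda>x. indicator E x * f x)"
    using integral_restrict_space[OF E, of f] integrable_restrict_space[OF E, of f] by simp_all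
qed

lemma Cauchy_Schwarz_half_line:
  fixes f g :: "real \<Rightarrow> real"
  assumes [measurable]: "f \<in> borel_measurable half_line" "g \<in> borel_measurable half_line" "A \<in> sets borel"
  shows "(\<integral>\<^sup>+t\<in>A. ennreal \<bar>f t * g t\<bar> \<partial>half_line)\<^sup>2
    \<le> (\<integral>\<^sup>+t\<in>A. ennreal ((f t)\<^sup>2) \<partial>half_line) * (\<integral>\<^sup>+t\<in>A. ennreal ((g t)\<^sup>2) \<partial>half_line)"
proof -
  have "(\<integral>\<^sup>+t\<in>A. ennreal \<bar>f t * g t\<bar> \<partial>half_line)
    = (\<integral>\<^sup>+t. (ennreal \<bar>f t\<bar> * indicator A t) * (ennreal \<bar>g t\<bar> * indicator A t) \<partial>half_line)"
    by (intro nn_integral_cong) (auto simp: indicator_def abs_mult ennreal_mult)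
  also have "\<dots>\<^sup>2 \<le> (\<integral>\<^sup>+t. (ennreal \<bar>f t\<bar> * indicator A t)\<^sup>2 \<partial>half_line)
    * (\<integral>\<^sup>+t. (ennreal \<bar>g t\<bar> * indicator A t)\<^sup>2 \<partial>half_line)"
    by (rule Cauchy_Schwarz_nn_integral) measurable
  also have "(\<integral>\<^sup>+t. (ennreal \<bar>f t\<bar> * indicator A t)\<^sup>2 \<partial>half_line) = (\<integral>\<^sup>+t\<in>A. ennreal ((f t)\<^sup>2) \<partial>half_line)"
    by (intro nn_integral_cong) (auto simp: indicator_def ennreal_power)
  also have "(\<integral>\<^sup>+t. (ennreal \<bar>g t\<bar> * indicator A t)\<^sup>2 \<partial>half_line) = (\<integral>\<^sup>+t\<in>A. ennreal ((g t)\<^sup>2) \<partial>half_line)"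
    by (intro nn_integral_cong) (auto simp: indicator_def ennreal_power)
  finally show ?thesis .
qed

lemma set_nn_integral_subset:
  "A \<subseteq> A' \<Longrightarrow> (\<integral>\<^sup>+x\<in>A. f x \<partial>M) \<le> (\<integral>\<^sup>+x\<in>A'. f x \<partial>M)"
  by (intro nn_integral_mono mult_left_mono) (auto simp: indicator_def)

text \<open>The primitive is monotone, and monotone real functions are Borel; finiteness allows it
  to be treated as real-valued.\<close>

lemma half_line_primitive_measurable:
  fixes h :: "real \<Rightarrow> ennreal"
  assumes fin: "\<And>x. 0 < x \<Longrightarrow> (\<integral>\<^sup>+t\<in>{0<..<x}. h t \<partial>half_line) < top"
  shows "(\<lambda>x. \<integral>\<^sup>+t\<in>{0<..<x}. h t \<partial>half_line) \<in> borel_measurable half_line"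
proof -
  define G where "G x = (\<integral>\<^sup>+t\<in>{0<..<x}. h t \<partial>half_line)" for x
  have G_mono: "G x \<le> G y" if "x \<le> y" for x y
    unfolding G_def using that by (intro set_nn_integral_subset) auto
  have G_fin: "G x < top" for x
    using fin[of "max x 1"] G_mono[of x "max x 1"] by (auto simp: G_def intro: le_less_trans)
  have "mono (\<lambda>x. enn2real (G x))"
    using G_mono G_fin by (auto intro!: monoI enn2real_mono)
  then have "(\<lambda>x. ennreal (enn2real (G x))) \<in> borel_measurable half_line"
    by (intro measurable_compose[OF measurable_ident_half_line] measurable_ennreal borel_measurable_mono
      measurable_compose[OF _ measurable_ennreal])
  moreover have "(\<lambda>x. ennreal (enn2real (G x))) = G" using G_fin by auto
  ultimately show ?thesis unfolding G_def by (simp only:)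
qed

section \<open>The weighted Hardy inequality\<close>

text \<open>
  Cutting \<open>(0, R)\<close> at points where the primitive \<open>G\<close> of \<open>\<bar>\<phi> g\<bar>\<close> equals \<open>G R / 2 ^ j\<close> avoids both
  Fubini's theorem and integration by parts: on each piece \<open>G\<close> is at most four times its
  increment over the piece to the left, and Cauchy--Schwarz bounds that increment.
\<close>

lemma weighted_Hardy_inequality:
  fixes b \<phi> g :: "real \<Rightarrow> real" and K :: ennreal
  assumes [measurable]: "b \<in> borel_measurable half_line" "\<phi> \<in> borel_measurable half_line"
      "g \<in> borel_measurable half_line"
    and K: "\<And>r. 0 < r \<Longrightarrow> (\<integral>\<^sup>+x\<in>{r<..}. ennreal ((b x)\<^sup>2) \<partial>half_line)
      * (\<integral>\<^sup>+x\<in>{0<..<r}. ennreal ((\<phi> x)\<^sup>2) \<partial>half_line) \<le> K"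
    and \<phi>: "\<And>r. 0 < r \<Longrightarrow> (\<integral>\<^sup>+x\<in>{0<..<r}. ennreal ((\<phi> x)\<^sup>2) \<partial>half_line) < \<infinity>"
    and g: "(\<integral>\<^sup>+x. ennreal ((g x)\<^sup>2) \<partial>half_line) < \<infinity>"
  shows "(\<integral>\<^sup>+x. ennreal ((b x)\<^sup>2) * (\<integral>\<^sup>+t\<in>{0<..<x}. ennreal \<bar>\<phi> t * g t\<bar> \<partial>half_line)\<^sup>2 \<partial>half_line)
    \<le> 16 * K * (\<integral>\<^sup>+x. ennreal ((g x)\<^sup>2) \<partial>half_line)"
proof -
  define G where "G x = (\<integral>\<^sup>+t\<in>{0<..<x}. ennreal \<bar>\<phi> t * g t\<bar> \<partial>half_line)" for x
  define I where "I = (\<integral>\<^sup>+x. ennreal ((g x)\<^sup>2) \<partial>half_line)"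
  have G_pos_fin: "G x < top" if "0 < x" for x
  proof -
    have "(G x)\<^sup>2 \<le> (\<integral>\<^sup>+t\<in>{0<..<x}. ennreal ((\<phi> t)\<^sup>2) \<partial>half_line) * (\<integral>\<^sup>+t\<in>{0<..<x}. ennreal ((g t)\<^sup>2) \<partial>half_line)"
      unfolding G_def by (rule Cauchy_Schwarz_half_line) auto
    also have "\<dots> \<le> (\<integral>\<^sup>+t\<in>{0<..<x}. ennreal ((\<phi> t)\<^sup>2) \<partial>half_line) * I"
      unfolding I_def by (intro mult_left_mono nn_integral_mono) (auto simp: indicator_def)
    also have "\<dots> < top" using \<phi>[OF that] g by (simp add: I_def ennreal_mult_less_top)
    finally show ?thesis by (simp add: ennreal_power2_less_top_iff)
  qed
  have G_mono: "G x \<le> G y" if "x \<le> y" for x y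
    unfolding G_def using that by (intro set_nn_integral_subset) auto
  have G_fin: "G x < top" for x
    using G_pos_fin[of "max x 1"] G_mono[of x "max x 1"] by (auto intro: le_less_trans)
  have G_meas [measurable]: "G \<in> borel_measurable half_line"
    using half_line_primitive_measurable[of "\<lambda>t. ennreal \<bar>\<phi> t * g t\<bar>"] G_pos_fin
    unfolding G_def by blast
  \<comment> \<open>Truncation at \<open>R\<close> provides a finite top level \<open>G R\<close>
    from which to halve; \<open>R\<close> tends to infinity at the end by monotone
    convergence.\<close>
  have main: "(\<integral>\<^sup>+x\<in>{0<..<R}. ennreal ((b x)\<^sup>2) * (G x)\<^sup>2 \<partial>half_line) \<le> 16 * K * I" if "0 < R" for R
  proof (cases "G R = 0")
    case True
    have "(\<integral>\<^sup>+x\<in>{0<..<R}. ennreal ((b x)\<^sup>2) * (G x)\<^sup>2 \<partial>half_line) = (\<integral>\<^sup>+x. 0 \<partial>half_line)"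
      using G_mono[of _ R] True by (intro nn_integral_cong) (auto simp: indicator_def)
    then show ?thesis by simp
  next
    case False
    obtain T where T: "G R = ennreal T" "0 < T"
      using G_fin[of R] False by (cases "G R") (auto simp: less_le)
    have "\<exists>y. 0 < y \<and> y \<le> R \<and> G y = ennreal (T / 2 ^ j)" for j
      unfolding G_def using T \<open>0 < R\<close>
      by (intro half_line_primitive_attains[where T=T]) (auto simp: G_def field_simps)
    then obtain y where y: "\<And>j. 0 < y j" "\<And>j. y j \<le> R" "\<And>j. G (y j) = ennreal (T / 2 ^ j)"
      by metis
    have y_Suc: "y (Suc j) < y j" for j
    proof (rule ccontr)
      assume "\<not> y (Suc j) < y j"
      then have "ennreal (T / 2 ^ j) \<le> ennreal (T / 2 ^ Suc j)"
        using G_mono[of "y j" "y (Suc j)"] by (simp add: y)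
      then show False using T by (simp add: field_simps ennreal_le_iff2)
    qed
    have y_decseq: "y j \<le> y i" if "i \<le> j" for i j
      using that y_Suc by (meson decseq_SucI decseq_def less_imp_le)
    \<comment> \<open>The index is shifted: where \<open>G\<close> lies between
      \<open>T / 2 ^ Suc j\<close> and \<open>T / 2 ^ j\<close>, the point is to the right of
      \<open>y (Suc j)\<close>, while \<open>J j\<close> is the piece just to the left of it. Over
      \<open>J j\<close> the increment of \<open>G\<close> is a quarter of \<open>T / 2 ^ j\<close>;
      squared, this is the factor 16.\<close>
    define J where "J j = {y (Suc (Suc j))<..<y (Suc j)}" for j
    have disj: "disjoint_family J"
    proof -
      have "J i \<inter> J j = {}" if "i < j" for i j
        using y_decseq[of "Suc (Suc i)" "Suc j"] that by (auto simp: J_def)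
      then show ?thesis unfolding disjoint_family_on_def by (metis Int_commute linorder_neqE_nat)
    qed
    have "(\<integral>\<^sup>+x\<in>{0<..<R}. ennreal ((b x)\<^sup>2) * (G x)\<^sup>2 \<partial>half_line)
      \<le> (\<integral>\<^sup>+x. (\<Sum>j. ennreal ((T / 2 ^ j)\<^sup>2) * (ennreal ((b x)\<^sup>2) * indicator {y (Suc j)<..} x)) \<partial>half_line)"
    proof (intro nn_integral_mono)
      fix x
      show "ennreal ((b x)\<^sup>2) * (G x)\<^sup>2 * indicator {0<..<R} x
        \<le> (\<Sum>j. ennreal ((T / 2 ^ j)\<^sup>2) * (ennreal ((b x)\<^sup>2) * indicator {y (Suc j)<..} x))"
      proof (cases "0 < x \<and> x < R \<and> G x \<noteq> 0")
        case True
        obtain t where t: "G x = ennreal t" "0 < t"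
          using G_fin[of x] True by (cases "G x") (auto simp: less_le)
        have "t \<le> T" using G_mono[of x R] True t T by (auto simp: ennreal_le_iff2)
        have "\<exists>n. T / 2 ^ n < t"
        proof -
          obtain n where "(1/2) ^ n < t / T"
            using real_arch_pow_inv[of "t / T" "1/2"] t T by auto
          then show ?thesis using T by (intro exI[of _ n]) (simp add: field_simps)
        qed
        \<comment> \<open>The least index places \<open>G x\<close> between \<open>T / 2 ^ n\<close>
          and \<open>T / 2 ^ (n - 1)\<close>; because of \<open>t \<le> T\<close> it cannot be
          0.\<close>
        then obtain n where n: "T / 2 ^ n < t" and least: "\<And>m. m < n \<Longrightarrow> t \<le> T / 2 ^ m"
          unfolding exists_least_iff[of "\<lambda>n. T / 2 ^ n < t"] not_less by blast
        have "n \<noteq> 0" using n \<open>t \<le> T\<close> by (cases n) auto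
        then obtain j where j: "n = Suc j" by (cases n) auto
        have tj: "t \<le> T / 2 ^ j" using least[of j] j by simp
        have "y (Suc j) < x"
        proof (rule ccontr)
          assume "\<not> y (Suc j) < x"
          then have "ennreal t \<le> ennreal (T / 2 ^ Suc j)" using G_mono[of x "y (Suc j)"] t y by simp
          then show False using n j t by (auto simp: ennreal_le_iff2)
        qed
        have "ennreal ((b x)\<^sup>2) * (G x)\<^sup>2 * indicator {0<..<R} x
          \<le> ennreal ((T / 2 ^ j)\<^sup>2) * (ennreal ((b x)\<^sup>2) * indicator {y (Suc j)<..} x)"
        proof -
          have "(G x)\<^sup>2 \<le> ennreal ((T / 2 ^ j)\<^sup>2)"
            using t tj by (simp add: ennreal_power power_mono)
          then have "ennreal ((b x)\<^sup>2) * (G x)\<^sup>2 \<le> ennreal ((b x)\<^sup>2) * ennreal ((T / 2 ^ j)\<^sup>2)"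
            by (rule mult_left_mono) simp
          then show ?thesis using True \<open>y (Suc j) < x\<close> by (simp add: mult.commute)
        qed
        also have "\<dots> \<le> (\<Sum>j. ennreal ((T / 2 ^ j)\<^sup>2) * (ennreal ((b x)\<^sup>2) * indicator {y (Suc j)<..} x))"
          using sum_le_suminf[OF summableI, of "{j}" "\<lambda>j. ennreal ((T / 2 ^ j)\<^sup>2) * (ennreal ((b x)\<^sup>2) * indicator {y (Suc j)<..} x)"]
          by simp
        finally show ?thesis .
      qed (auto simp: indicator_def)
    qed
    also have "\<dots> = (\<Sum>j. ennreal ((T / 2 ^ j)\<^sup>2) * (\<integral>\<^sup>+x\<in>{y (Suc j)<..}. ennreal ((b x)\<^sup>2) \<partial>half_line))"
      by (subst nn_integral_suminf) (auto simp: nn_integral_cmult)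
    also have "\<dots> \<le> (\<Sum>j. 16 * K * (\<integral>\<^sup>+x\<in>J j. ennreal ((g x)\<^sup>2) \<partial>half_line))"
    proof (intro suminf_le summableI)
      fix j
      let ?\<Phi> = "\<integral>\<^sup>+x\<in>{0<..<y (Suc j)}. ennreal ((\<phi> x)\<^sup>2) \<partial>half_line"
      let ?g = "\<integral>\<^sup>+x\<in>J j. ennreal ((g x)\<^sup>2) \<partial>half_line"
      let ?b = "\<integral>\<^sup>+x\<in>{y (Suc j)<..}. ennreal ((b x)\<^sup>2) \<partial>half_line"
      have "G (y (Suc j)) = G (y (Suc (Suc j))) + (\<integral>\<^sup>+t\<in>J j. ennreal \<bar>\<phi> t * g t\<bar> \<partial>half_line)"
        unfolding G_def J_def by (rule nn_integral_half_line_split) (use y y_Suc in auto)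
      then have "ennreal (T / 2 ^ Suc j) - ennreal (T / 2 ^ Suc (Suc j)) = (\<integral>\<^sup>+t\<in>J j. ennreal \<bar>\<phi> t * g t\<bar> \<partial>half_line)"
        unfolding y by (metis ennreal_add_diff_cancel_left ennreal_neq_top)
      moreover have "ennreal (T / 2 ^ Suc j) - ennreal (T / 2 ^ Suc (Suc j)) = ennreal (T / 2 ^ Suc j - T / 2 ^ Suc (Suc j))"
        using T by (intro ennreal_minus) simp
      ultimately have "(\<integral>\<^sup>+t\<in>J j. ennreal \<bar>\<phi> t * g t\<bar> \<partial>half_line) = ennreal (T / 2 ^ Suc j - T / 2 ^ Suc (Suc j))"
        by metis
      also have "T / 2 ^ Suc j - T / 2 ^ Suc (Suc j) = T / 2 ^ j / 4" by (simp add: field_simps)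
      finally have "ennreal ((T / 2 ^ j / 4)\<^sup>2) = (\<integral>\<^sup>+t\<in>J j. ennreal \<bar>\<phi> t * g t\<bar> \<partial>half_line)\<^sup>2"
        using T by (simp add: ennreal_power)
      also have "\<dots> \<le> (\<integral>\<^sup>+t\<in>J j. ennreal ((\<phi> t)\<^sup>2) \<partial>half_line) * ?g"
        by (rule Cauchy_Schwarz_half_line) (auto simp: J_def)
      also have "\<dots> \<le> ?\<Phi> * ?g"
      proof (intro mult_right_mono set_nn_integral_subset)
        show "J j \<subseteq> {0<..<y (Suc j)}" using y(1)[of "Suc (Suc j)"] by (auto simp: J_def)
      qed simp
      finally have le: "ennreal ((T / 2 ^ j / 4)\<^sup>2) \<le> ?\<Phi> * ?g" .
      have "ennreal ((T / 2 ^ j)\<^sup>2) * ?b = 16 * (ennreal ((T / 2 ^ j / 4)\<^sup>2) * ?b)"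
      proof -
        have "ennreal ((T / 2 ^ j)\<^sup>2) = ennreal (16 * (T / 2 ^ j / 4)\<^sup>2)" by (simp add: power2_eq_square)
        also have "\<dots> = 16 * ennreal ((T / 2 ^ j / 4)\<^sup>2)" by (subst ennreal_mult) auto
        finally show ?thesis by (simp add: mult.assoc)
      qed
      also have "\<dots> \<le> 16 * ((?\<Phi> * ?g) * ?b)" using le by (intro mult_left_mono mult_right_mono) auto
      also have "\<dots> = 16 * ((?b * ?\<Phi>) * ?g)" by (simp add: mult_ac)
      also have "\<dots> \<le> 16 * (K * ?g)" using K[OF y(1)] by (intro mult_left_mono mult_right_mono) auto
      finally show "ennreal ((T / 2 ^ j)\<^sup>2) * ?b \<le> 16 * K * ?g" by (simp add: mult.assoc)
    qed
    also have "\<dots> = 16 * K * (\<integral>\<^sup>+x\<in>(\<Union>j. J j). ennreal ((g x)\<^sup>2) \<partial>half_line)"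
    proof -
      have "(\<integral>\<^sup>+x\<in>(\<Union>j. J j). ennreal ((g x)\<^sup>2) \<partial>half_line)
        = (\<integral>\<^sup>+x. (\<Sum>j. ennreal ((g x)\<^sup>2) * indicator (J j) x) \<partial>half_line)"
        using disj by (intro nn_integral_cong) (simp add: suminf_indicator)
      also have "\<dots> = (\<Sum>j. \<integral>\<^sup>+x\<in>J j. ennreal ((g x)\<^sup>2) \<partial>half_line)"
        by (intro nn_integral_suminf) (auto simp: J_def)
      finally show ?thesis by simp
    qed
    also have "\<dots> \<le> 16 * K * I"
      unfolding I_def by (intro mult_left_mono nn_integral_mono) (auto simp: indicator_def)
    finally show ?thesis .
  qed
  have "(\<integral>\<^sup>+x. ennreal ((b x)\<^sup>2) * (G x)\<^sup>2 \<partial>half_line)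
    = (\<integral>\<^sup>+x. (SUP m::nat. ennreal ((b x)\<^sup>2) * (G x)\<^sup>2 * indicator {0<..<real m} x) \<partial>half_line)"
  proof (intro nn_integral_cong antisym SUP_least)
    fix x assume "x \<in> space half_line"
    then have "0 < x" by simp
    obtain m where "x < real m" using reals_Archimedean2 by blast
    with \<open>0 < x\<close> show "ennreal ((b x)\<^sup>2) * (G x)\<^sup>2 \<le> (SUP m::nat. ennreal ((b x)\<^sup>2) * (G x)\<^sup>2 * indicator {0<..<real m} x)"
      by (intro SUP_upper2[of m]) auto
  qed (auto simp: indicator_def)
  also have "\<dots> = (SUP m::nat. \<integral>\<^sup>+x\<in>{0<..<real m}. ennreal ((b x)\<^sup>2) * (G x)\<^sup>2 \<partial>half_line)"
    by (rule nn_integral_monotone_convergence_SUP)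
      (auto simp: incseq_def le_fun_def indicator_def)
  also have "\<dots> \<le> 16 * K * I"
  proof (rule SUP_least)
    fix m :: nat
    show "(\<integral>\<^sup>+x\<in>{0<..<real m}. ennreal ((b x)\<^sup>2) * (G x)\<^sup>2 \<partial>half_line) \<le> 16 * K * I"
      using main[of "real m"] by (cases "m = 0") auto
  qed
  finally show ?thesis by (simp add: G_def I_def)
qed

section \<open>Interpolation, doubling and mean values\<close>

text \<open>Induction by removing one node z: in p = p(z) + (X - z) q the quotient q has degree at
  most n, and its values at the remaining nodes are at most 2 M / \<sigma>, since these nodes keep
  distance \<sigma> from z. The constant depends on n and \<sigma> alone.\<close>

lemma bounded_coefficients_of_interpolation:
  fixes \<sigma> :: real
  assumes "0 < \<sigma>"
  shows "\<exists>K\<ge>0. \<forall>(p::real poly) M \<xi>. degree p \<le> n \<longrightarrow> (\<forall>i\<le>n. 0 \<le> \<xi> i \<and> \<xi> i \<le> 1) \<longrightarrow>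
    (\<forall>i\<le>n. \<forall>j<i. \<sigma> \<le> \<bar>\<xi> i - \<xi> j\<bar>) \<longrightarrow> (\<forall>i\<le>n. \<bar>poly p (\<xi> i)\<bar> \<le> M) \<longrightarrow>
    (\<forall>k. \<bar>coeff p k\<bar> \<le> K * M)"
proof (induction n)
  case 0
  show ?case
  proof (intro exI[of _ 1] conjI allI impI)
    fix p :: "real poly" and M \<xi> k
    assume "degree p \<le> 0" and M: "\<forall>i\<le>0::nat. \<bar>poly p (\<xi> i)\<bar> \<le> M"
    then obtain c where "p = [:c:]" by (metis degree_eq_zeroE le_zero_eq)
    with M show "\<bar>coeff p k\<bar> \<le> 1 * M"
      using abs_ge_zero[of c] by (auto simp: coeff_pCons split: nat.split simp del: abs_ge_zero)
  qed simp
next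
  case (Suc n)
  obtain K where "0 \<le> K" and K: "\<forall>(p::real poly) M \<xi>. degree p \<le> n \<longrightarrow> (\<forall>i\<le>n. 0 \<le> \<xi> i \<and> \<xi> i \<le> 1) \<longrightarrow>
    (\<forall>i\<le>n. \<forall>j<i. \<sigma> \<le> \<bar>\<xi> i - \<xi> j\<bar>) \<longrightarrow> (\<forall>i\<le>n. \<bar>poly p (\<xi> i)\<bar> \<le> M) \<longrightarrow>
    (\<forall>k. \<bar>coeff p k\<bar> \<le> K * M)"
    using Suc.IH by (elim exE conjE) (rule that)
  show ?case
  \<comment> \<open>M bounds the constant p(z); the coefficients of X q and of z q are each at most
    K * (2 M / \<sigma>), the latter because z lies in [0, 1].\<close>
  proof (intro exI[of _ "1 + 4 * K / \<sigma>"] conjI allI impI)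
    show "0 \<le> 1 + 4 * K / \<sigma>" using \<open>0 \<le> K\<close> \<open>0 < \<sigma>\<close> by simp
    fix p :: "real poly" and M \<xi> k
    assume deg: "degree p \<le> Suc n" and \<xi>: "\<forall>i\<le>Suc n. 0 \<le> \<xi> i \<and> \<xi> i \<le> 1"
      and sep: "\<forall>i\<le>Suc n. \<forall>j<i. \<sigma> \<le> \<bar>\<xi> i - \<xi> j\<bar>" and M: "\<forall>i\<le>Suc n. \<bar>poly p (\<xi> i)\<bar> \<le> M"
    define z where "z = \<xi> (Suc n)"
    define q where "q = synthetic_div p z"
    have p: "p = [:poly p z:] + pCons 0 q - smult z q"
      using synthetic_div_correct[of p z] by (simp add: q_def algebra_simps)
    have pz: "\<bar>poly p z\<bar> \<le> M" using M by (simp add: z_def)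
    have "0 \<le> M" using pz by linarith
    have "\<bar>poly q (\<xi> i)\<bar> \<le> 2 * M / \<sigma>" if "i \<le> n" for i
    proof -
      have "poly p (\<xi> i) = poly p z + (\<xi> i - z) * poly q (\<xi> i)"
        by (subst p) (simp add: algebra_simps)
      then have "\<bar>\<xi> i - z\<bar> * \<bar>poly q (\<xi> i)\<bar> = \<bar>poly p (\<xi> i) - poly p z\<bar>"
        by (simp add: abs_mult)
      also have "\<dots> \<le> 2 * M" using M pz that by (smt (verit) le_SucI)
      finally have "\<bar>\<xi> i - z\<bar> * \<bar>poly q (\<xi> i)\<bar> \<le> 2 * M" .
      moreover have "\<sigma> \<le> \<bar>\<xi> i - z\<bar>" using sep that unfolding z_def
        by (metis abs_minus_commute le_imp_less_Suc le_refl)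
      ultimately have "\<sigma> * \<bar>poly q (\<xi> i)\<bar> \<le> 2 * M"
        by (meson abs_ge_zero mult_right_mono order_trans)
      then show ?thesis using \<open>0 < \<sigma>\<close> by (simp add: field_simps)
    qed
    then have cq: "\<bar>coeff q k\<bar> \<le> K * (2 * M / \<sigma>)" for k
      using \<xi> sep deg by (intro K[rule_format, where \<xi>=\<xi>]) (auto simp: q_def degree_synthetic_div)
    have z: "0 \<le> z" "z \<le> 1" using \<xi> by (auto simp: z_def)
    have zc: "\<bar>z * coeff q k\<bar> \<le> K * (2 * M / \<sigma>)" for k
      using mult_mono[of "\<bar>z\<bar>" 1 "\<bar>coeff q k\<bar>" "K * (2 * M / \<sigma>)"] cq[of k] z
      by (auto simp: abs_mult)
    have "coeff p k = coeff [:poly p z:] k + coeff (pCons 0 q) k - z * coeff q k"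
      by (subst p) (simp add: coeff_pCons split: nat.split)
    moreover have "\<bar>coeff [:poly p z:] k\<bar> \<le> M" using pz \<open>0 \<le> M\<close> by (auto simp: coeff_pCons split: nat.split)
    moreover have "\<bar>coeff (pCons 0 q) k\<bar> \<le> K * (2 * M / \<sigma>)"
      using cq \<open>0 \<le> K\<close> \<open>0 \<le> M\<close> \<open>0 < \<sigma>\<close> by (auto simp: coeff_pCons split: nat.split)
    ultimately have "\<bar>coeff p k\<bar> \<le> M + K * (2 * M / \<sigma>) + K * (2 * M / \<sigma>)"
      using zc[of k] by linarith
    then show "\<bar>coeff p k\<bar> \<le> (1 + 4 * K / \<sigma>) * M" by (simp add: algebra_simps)
  qed
qed

text \<open>The interval is grown rather than shrunk: each use of doubling makes it at least 4/3
  times as long at the price of a factor \<open>d\<close>. The invariant that the left endpoint is 0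
  or the centre is at most \<open>r\<close> ensures that a sufficiently long interval contains (0,
  r).\<close>

lemma doubling_iterate:
  fixes m :: "real \<Rightarrow> real \<Rightarrow> ennreal" and \<delta> r :: real
  assumes mono: "\<And>\<alpha> \<beta> \<alpha>' \<beta>'. \<alpha>' \<le> \<alpha> \<Longrightarrow> \<beta> \<le> \<beta>' \<Longrightarrow> m \<alpha> \<beta> \<le> m \<alpha>' \<beta>'"
    and doubling: "\<And>a b. 0 \<le> a \<Longrightarrow> a < b \<Longrightarrow> \<delta> \<le> b - a \<Longrightarrow> m a b \<le> d * m ((3 * a + b) / 4) ((a + 3 * b) / 4)"
    and "0 < r" "0 \<le> \<alpha>" "\<alpha> < \<beta>" "\<delta> \<le> \<beta> - \<alpha>" "\<alpha> = 0 \<or> \<alpha> + \<beta> \<le> 2 * r"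
    and "2 * r < (4/3) ^ N * (\<beta> - \<alpha>)"
  shows "m 0 r \<le> d ^ N * m \<alpha> \<beta>"
  using assms(4-)
proof (induction N arbitrary: \<alpha> \<beta>)
  case 0
  \<comment> \<open>A length above 2 r together with a centre at most r would force a negative left
    endpoint.\<close>
  then have "\<alpha> = 0" "r \<le> \<beta>" using \<open>0 < r\<close> by auto
  then show ?case using mono[of 0 0 r \<beta>] by simp
next
  case (Suc N)
  show ?case
  proof (cases "3 * \<alpha> \<le> \<beta>")
    case True
    \<comment> \<open>The concentric interval of twice the length could leave the half-line. Its
      replacement (0, 4 \<beta> / 3) has the concentric half (\<beta> / 3, \<beta>), which is
      contained in (\<alpha>, \<beta>).\<close>
    have "m 0 r \<le> d ^ N * m 0 (4 / 3 * \<beta>)"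
    proof (rule Suc.IH)
      have "(4/3) ^ Suc N * (\<beta> - \<alpha>) \<le> (4/3) ^ Suc N * \<beta>"
        using Suc.prems by (intro mult_left_mono) auto
      also have "\<dots> = (4/3) ^ N * (4 / 3 * \<beta> - 0)" by simp
      finally show "2 * r < (4/3) ^ N * (4 / 3 * \<beta> - 0)" using Suc.prems(5) by linarith
    qed (use Suc.prems in auto)
    moreover have "m 0 (4 / 3 * \<beta>) \<le> d * m ((3 * 0 + 4/3 * \<beta>) / 4) ((0 + 3 * (4/3 * \<beta>)) / 4)"
      using Suc.prems by (intro doubling) auto
    moreover have "\<dots> \<le> d * m \<alpha> \<beta>" using True by (intro mult_left_mono mono) auto
    ultimately have "m 0 r \<le> d ^ N * (d * m \<alpha> \<beta>)"
      by (meson mult_left_mono order_trans zero_le)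
    then show ?thesis by (simp add: mult_ac)
  next
    case False
    \<comment> \<open>The concentric interval of twice the length; \<beta> < 3 \<alpha> keeps its
      left endpoint nonnegative.\<close>
    define \<alpha>' \<beta>' where "\<alpha>' = (3 * \<alpha> - \<beta>) / 2" and "\<beta>' = (3 * \<beta> - \<alpha>) / 2"
    have half: "(3 * \<alpha>' + \<beta>') / 4 = \<alpha>" "(\<alpha>' + 3 * \<beta>') / 4 = \<beta>" and len: "\<beta>' - \<alpha>' = 2 * (\<beta> - \<alpha>)"
      and sum: "\<alpha>' + \<beta>' = \<alpha> + \<beta>"
      by (simp_all add: \<alpha>'_def \<beta>'_def field_simps)
    have "0 \<le> \<alpha>'" using False by (simp add: \<alpha>'_def)
    have "m 0 r \<le> d ^ N * m \<alpha>' \<beta>'"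
    proof (rule Suc.IH)
      have "(4/3) ^ Suc N * (\<beta> - \<alpha>) \<le> (4/3) ^ N * (2 * (\<beta> - \<alpha>))"
        using Suc.prems by simp
      with Suc.prems(5) show "2 * r < (4/3) ^ N * (\<beta>' - \<alpha>')" unfolding len by linarith
      show "\<alpha>' = 0 \<or> \<alpha>' + \<beta>' \<le> 2 * r" using Suc.prems False sum by auto
    qed (use Suc.prems \<open>0 \<le> \<alpha>'\<close> len in auto)
    moreover have "m \<alpha>' \<beta>' \<le> d * m \<alpha> \<beta>"
    proof -
      have "\<alpha>' < \<beta>'" "\<delta> \<le> \<beta>' - \<alpha>'" using Suc.prems len by auto
      then show ?thesis using doubling[of \<alpha>' \<beta>', unfolded half] \<open>0 \<le> \<alpha>'\<close> by blast
    qed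
    ultimately have "m 0 r \<le> d ^ N * (d * m \<alpha> \<beta>)"
      by (meson mult_left_mono order_trans zero_le)
    then show ?thesis by (simp add: mult_ac)
  qed
qed

text \<open>The quotient of the two integrals lies between the minimum and the maximum of
  \<open>p\<close> on the interval, and the image of the interval under \<open>p\<close> is
  connected.\<close>

lemma weighted_mean_value:
  fixes p f :: "real \<Rightarrow> real"
  assumes p: "continuous_on UNIV p" and f: "integrable half_line f" "\<And>t. 0 \<le> f t"
    and supp: "\<And>t. t \<notin> {\<alpha>..\<beta>} \<Longrightarrow> f t = 0" and "\<alpha> \<le> \<beta>" and pos: "0 < (LINT t|half_line. f t)"
  shows "\<exists>\<xi>\<in>{\<alpha>..\<beta>}. (LINT t|half_line. p t * f t) = p \<xi> * (LINT t|half_line. f t)"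
proof -
  have cont: "continuous_on {\<alpha>..\<beta>} p" using p continuous_on_subset by blast
  obtain c where c: "c \<in> {\<alpha>..\<beta>}" "\<And>t. t \<in> {\<alpha>..\<beta>} \<Longrightarrow> p c \<le> p t"
    using continuous_attains_inf[OF compact_Icc _ cont] \<open>\<alpha> \<le> \<beta>\<close> by auto
  obtain d where d: "d \<in> {\<alpha>..\<beta>}" "\<And>t. t \<in> {\<alpha>..\<beta>} \<Longrightarrow> p t \<le> p d"
    using continuous_attains_sup[OF compact_Icc _ cont] \<open>\<alpha> \<le> \<beta>\<close> by auto
  have le: "p c * f t \<le> p t * f t" "p t * f t \<le> p d * f t" for t
    using c d f(2) supp by (cases "t \<in> {\<alpha>..\<beta>}"; auto intro: mult_right_mono)+
  have [measurable]: "p \<in> borel_measurable half_line"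
    using p by (intro measurable_compose[OF measurable_ident_half_line] borel_measurable_continuous_onI)
  have [measurable]: "f \<in> borel_measurable half_line" using f by auto
  have int: "integrable half_line (\<lambda>t. p t * f t)"
  proof (rule Bochner_Integration.integrable_bound)
    show "integrable half_line (\<lambda>t. (\<bar>p c\<bar> + \<bar>p d\<bar>) * f t)" using f by simp
    have "\<bar>p t * f t\<bar> \<le> (\<bar>p c\<bar> + \<bar>p d\<bar>) * f t" for t
    proof -
      have "\<bar>p c * f t\<bar> \<le> \<bar>p c\<bar> * f t" "\<bar>p d * f t\<bar> \<le> \<bar>p d\<bar> * f t" using f(2) by (simp_all add: abs_mult)
      then show ?thesis using le[of t] f(2)[of t] by (simp only: distrib_right)
    qed
    then show "AE t in half_line. norm (p t * f t) \<le> norm ((\<bar>p c\<bar> + \<bar>p d\<bar>) * f t)"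
      using f(2) by (intro AE_I2) (simp add: abs_mult)
  qed measurable
  let ?I = "LINT t|half_line. f t" and ?q = "(LINT t|half_line. p t * f t) / (LINT t|half_line. f t)"
  have "(LINT t|half_line. p c * f t) \<le> (LINT t|half_line. p t * f t)"
      "(LINT t|half_line. p t * f t) \<le> (LINT t|half_line. p d * f t)"
    by (intro integral_mono le int integrable_mult_right f(1))+
  then have "p c * ?I \<le> (LINT t|half_line. p t * f t)" "(LINT t|half_line. p t * f t) \<le> p d * ?I"
    by simp_all
  then have "p c \<le> ?q" "?q \<le> p d" using pos by (simp_all add: field_simps)
  moreover have "connected (p ` {\<alpha>..\<beta>})" by (intro connected_continuous_image cont) simp
  ultimately have "?q \<in> p ` {\<alpha>..\<beta>}"
    using connectedD_interval[of "p ` {\<alpha>..\<beta>}" "p c" "p d" ?q] c d by blast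
  then obtain \<xi> where "\<xi> \<in> {\<alpha>..\<beta>}" "?q = p \<xi>" by blast
  then show ?thesis using pos by (intro bexI[of _ \<xi>]) (auto simp: field_simps)
qed

section \<open>The polynomial operator\<close>

text \<open>The hypotheses shared by both directions. Doubling is kept out: apart from implying
  \<open>finite_weight\<close>, it serves only the necessity for large r.\<close>

locale weighted_polynomial_operator =
  fixes n :: nat and u v :: "real \<Rightarrow> real" and a :: "nat \<Rightarrow> real \<Rightarrow> real"
  assumes u_measurable [measurable]: "u \<in> borel_measurable half_line"
    and v_measurable [measurable]: "v \<in> borel_measurable half_line"
    and a_measurable: "\<And>k. k \<le> n \<Longrightarrow> a k \<in> borel_measurable half_line"
    and u_pos: "AE x in half_line. 0 < u x"
    and finite_weight: "\<And>r. 0 < r \<Longrightarrow> (\<integral>\<^sup>+x\<in>{0<..<r}. ennreal (inverse ((u x)\<^sup>2)) \<partial>half_line) < top"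
begin

definition w :: "real \<Rightarrow> real" where "w x = inverse ((u x)\<^sup>2)"

definition \<mu> :: "real \<Rightarrow> real \<Rightarrow> ennreal" where
  "\<mu> \<alpha> \<beta> = (\<integral>\<^sup>+x\<in>{\<alpha><..<\<beta>}. ennreal (w x) \<partial>half_line)"

text \<open>\<open>U\<close>, \<open>V\<close> and \<open>N\<close> are squared norms: as integrals
  they split additively over domains, and roots appear only in the final translation to
  \<open>L2norm\<close> and \<open>S\<close>.\<close>

definition U :: "nat \<Rightarrow> real \<Rightarrow> ennreal" where
  "U k r = (\<integral>\<^sup>+x\<in>{0<..<r}. ennreal ((x ^ k * inverse (u x))\<^sup>2) \<partial>half_line)"

definition V :: "nat \<Rightarrow> real set \<Rightarrow> ennreal" where
  "V k E = (\<integral>\<^sup>+x\<in>E. ennreal ((a k x * v x)\<^sup>2) \<partial>half_line)"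

definition N :: "(real \<Rightarrow> real) \<Rightarrow> ennreal" where
  "N f = (\<integral>\<^sup>+x. ennreal ((u x * f x)\<^sup>2) \<partial>half_line)"

text \<open>Both sides are squared norms, so \<open>C\<close> stands for the square of the operator
  constant.\<close>

definition op_bound :: "ennreal \<Rightarrow> bool" where
  "op_bound C \<longleftrightarrow> (\<forall>f \<in> borel_measurable half_line. N f < top \<longrightarrow>
    (\<integral>\<^sup>+x. ennreal ((v x * poly_op n a f x)\<^sup>2) \<partial>half_line) \<le> C * N f)"

definition moment :: "nat \<Rightarrow> (real \<Rightarrow> real) \<Rightarrow> real \<Rightarrow> real" where
  "moment k f x = (LINT t|lebesgue_on {0<..<x}. t ^ k * f t)"

lemma moment_eq: "moment k f x = (LINT t|half_line. indicator {0<..<x} t * (t ^ k * f t))"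
  unfolding moment_def by (rule integral_lebesgue_on_half_line) auto

lemma w_measurable [measurable]: "w \<in> borel_measurable half_line"
  unfolding w_def[abs_def] by measurable

lemma w_nonneg: "0 \<le> w x"
  by (simp add: w_def)

section \<open>Size and positivity of the masses of \<open>w\<close>\<close>

lemma U_eq: "U k r = (\<integral>\<^sup>+x\<in>{0<..<r}. ennreal (x ^ (2 * k) * w x) \<partial>half_line)"
  unfolding U_def w_def by (simp add: power_mult_distrib power_inverse power_mult[symmetric] mult.commute)

lemma U_mono: "r \<le> s \<Longrightarrow> U k r \<le> U k s"
  unfolding U_def by (intro set_nn_integral_subset) auto

lemma V_mono: "E \<subseteq> F \<Longrightarrow> V k E \<le> V k F"
  unfolding V_def by (intro set_nn_integral_subset)

lemma V_Un: "k \<le> n \<Longrightarrow> E \<in> sets borel \<Longrightarrow> F \<in> sets borel \<Longrightarrow> V k (E \<union> F) \<le> V k E + V k F"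
proof -
  assume k: "k \<le> n" and [measurable]: "E \<in> sets borel" "F \<in> sets borel"
  have [measurable]: "a k \<in> borel_measurable half_line" using a_measurable k .
  show ?thesis unfolding V_def
    by (subst nn_integral_add[symmetric], measurable, intro nn_integral_mono) (auto simp: indicator_def)
qed

lemma U_le: "0 < r \<Longrightarrow> U k r \<le> ennreal (r ^ (2 * k)) * \<mu> 0 r"
proof -
  assume r: "0 < r"
  have "U k r \<le> (\<integral>\<^sup>+x. ennreal (r ^ (2 * k)) * (ennreal (w x) * indicator {0<..<r} x) \<partial>half_line)"
    unfolding U_eq using r w_nonneg
    by (intro nn_integral_mono) (auto simp: indicator_def ennreal_mult'[symmetric] intro!: ennreal_leI mult_right_mono power_mono)
  then show ?thesis by (simp add: nn_integral_cmult \<mu>_def)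
qed

lemma \<mu>_less_top: "\<mu> \<alpha> \<beta> < top"
proof -
  have "\<mu> \<alpha> \<beta> \<le> \<mu> 0 (max \<beta> 1)"
    unfolding \<mu>_def by (intro nn_integral_mono) (auto simp: indicator_def)
  also have "\<dots> < top" using finite_weight[of "max \<beta> 1"] by (simp add: \<mu>_def w_def)
  finally show ?thesis .
qed

lemma \<mu>_mono: "\<alpha>' \<le> \<alpha> \<Longrightarrow> \<beta> \<le> \<beta>' \<Longrightarrow> \<mu> \<alpha> \<beta> \<le> \<mu> \<alpha>' \<beta>'"
  unfolding \<mu>_def by (intro set_nn_integral_subset) auto

lemma U_less_top: "0 < r \<Longrightarrow> U k r < top"
  using U_le[of r k] \<mu>_less_top[of 0 r] by (auto simp: ennreal_mult_less_top intro: le_less_trans)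

lemma interval_not_AE_empty:
  assumes "0 \<le> \<alpha>" "\<alpha> < \<beta>"
  shows "\<not> (AE x in half_line. x \<notin> {\<alpha><..<\<beta>})"
proof
  assume AE: "AE x in half_line. x \<notin> {\<alpha><..<\<beta>}"
  have "{\<alpha><..<\<beta>} \<in> sets half_line"
    using assms by (auto simp: sets_restrict_space intro!: image_eqI[of _ _ "{\<alpha><..<\<beta>}"])
  then have "emeasure half_line {\<alpha><..<\<beta>} = 0"
    using AE AE_iff_null_sets[of "{\<alpha><..<\<beta>}" half_line] by auto
  moreover have "emeasure half_line {\<alpha><..<\<beta>} = ennreal (\<beta> - \<alpha>)"
    using assms by (subst emeasure_restrict_space) auto
  ultimately show False using assms by simp
qed

lemma \<mu>_pos: "0 \<le> \<alpha> \<Longrightarrow> \<alpha> < \<beta> \<Longrightarrow> 0 < \<mu> \<alpha> \<beta>"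
proof (rule ccontr)
  assume *: "0 \<le> \<alpha>" "\<alpha> < \<beta>" and "\<not> 0 < \<mu> \<alpha> \<beta>"
  then have "AE x in half_line. ennreal (w x) * indicator {\<alpha><..<\<beta>} x = 0"
    by (subst nn_integral_0_iff_AE[symmetric]) (auto simp: \<mu>_def)
  with u_pos have "AE x in half_line. x \<notin> {\<alpha><..<\<beta>}"
    by eventually_elim (auto simp: w_def indicator_def)
  with * interval_not_AE_empty show False by blast
qed

lemma U_pos: "0 < r \<Longrightarrow> 0 < U k r"
proof (rule ccontr)
  assume *: "0 < r" and "\<not> 0 < U k r"
  then have "AE x in half_line. ennreal (x ^ (2 * k) * w x) * indicator {0<..<r} x = 0"
    by (subst nn_integral_0_iff_AE[symmetric]) (auto simp: U_eq)
  with u_pos have "AE x in half_line. x \<notin> {0<..<r}"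
    by eventually_elim
      (auto simp: w_def indicator_def ennreal_mult' ennreal_eq_0_iff not_le dest: zero_less_power[of _ "2 * k"])
  with * interval_not_AE_empty[of 0 r] show False by auto
qed

text \<open>Almost everywhere \<open>u^2 w^2 = w\<close>. Hence the norm of a test function
  \<open>h w\<close> is the norm of h with respect to the density \<open>w\<close>.\<close>

lemma N_times_w: "N (\<lambda>t. h t * w t) = (\<integral>\<^sup>+t. ennreal ((h t)\<^sup>2 * w t) \<partial>half_line)"
  unfolding N_def
proof (rule nn_integral_cong_AE, use u_pos in eventually_elim)
  fix x assume "0 < u x"
  then have "(u x * (h x * w x))\<^sup>2 = (h x)\<^sup>2 * w x"
    by (simp add: w_def field_simps power2_eq_square)
  then show "ennreal ((u x * (h x * w x))\<^sup>2) = ennreal ((h x)\<^sup>2 * w x)" by simp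
qed

section \<open>Moments of functions of finite norm\<close>

context
  fixes f :: "real \<Rightarrow> real"
  assumes f_measurable [measurable]: "f \<in> borel_measurable half_line" and N_fin: "N f < top"
begin

lemma monomial_nn_integral:
  "(\<integral>\<^sup>+t\<in>{0<..<x}. ennreal \<bar>t ^ k * f t\<bar> \<partial>half_line)
    = (\<integral>\<^sup>+t\<in>{0<..<x}. ennreal \<bar>(t ^ k * inverse (u t)) * (u t * f t)\<bar> \<partial>half_line)"
  using u_pos by (intro nn_integral_cong_AE) (auto simp: indicator_def abs_mult)

lemma monomial_power2_le:
  "(\<integral>\<^sup>+t\<in>{0<..<x}. ennreal \<bar>t ^ k * f t\<bar> \<partial>half_line)\<^sup>2 \<le> U k x * N f"
proof -
  have "(\<integral>\<^sup>+t\<in>{0<..<x}. ennreal \<bar>t ^ k * f t\<bar> \<partial>half_line)\<^sup>2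
    \<le> U k x * (\<integral>\<^sup>+t\<in>{0<..<x}. ennreal ((u t * f t)\<^sup>2) \<partial>half_line)"
    unfolding monomial_nn_integral U_def by (rule Cauchy_Schwarz_half_line) measurable
  also have "\<dots> \<le> U k x * N f"
    unfolding N_def by (intro mult_left_mono nn_integral_mono) (auto simp: indicator_def)
  finally show ?thesis .
qed

lemma monomial_less_top: "0 < x \<Longrightarrow> (\<integral>\<^sup>+t\<in>{0<..<x}. ennreal \<bar>t ^ k * f t\<bar> \<partial>half_line) < top"
  using le_less_trans[OF monomial_power2_le[of k x], of top] U_less_top[of x k] N_fin
  by (simp add: ennreal_power2_less_top_iff ennreal_mult_less_top)

lemma monomial_integrable:
  assumes "0 < x"
  shows "integrable (lebesgue_on {0<..<x}) (\<lambda>t. t ^ k * f t)"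
proof -
  have "integrable half_line (\<lambda>t. indicator {0<..<x} t * (t ^ k * f t))"
  proof (rule integrableI_bounded)
    have "(\<integral>\<^sup>+t. ennreal (norm (indicator {0<..<x} t * (t ^ k * f t))) \<partial>half_line)
      = (\<integral>\<^sup>+t\<in>{0<..<x}. ennreal \<bar>t ^ k * f t\<bar> \<partial>half_line)"
      by (intro nn_integral_cong) (auto simp: indicator_def)
    then show "(\<integral>\<^sup>+t. ennreal (norm (indicator {0<..<x} t * (t ^ k * f t))) \<partial>half_line) < \<infinity>"
      using monomial_less_top[OF assms] by simp
  qed measurable
  then show ?thesis by (subst integral_lebesgue_on_half_line) auto
qed

lemma moment_power2_le:
  assumes "0 < x"
  shows "ennreal ((moment k f x)\<^sup>2) \<le> (\<integral>\<^sup>+t\<in>{0<..<x}. ennreal \<bar>t ^ k * f t\<bar> \<partial>half_line)\<^sup>2"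
proof -
  have "ennreal \<bar>moment k f x\<bar> \<le> (\<integral>\<^sup>+t. ennreal \<bar>t ^ k * f t\<bar> \<partial>lebesgue_on {0<..<x})"
    unfolding moment_def
    using integral_norm_bound_ennreal[OF monomial_integrable[OF assms], of k] by simp
  also have "\<dots> = (\<integral>\<^sup>+t\<in>{0<..<x}. ennreal \<bar>t ^ k * f t\<bar> \<partial>half_line)"
    by (rule nn_integral_lebesgue_on_half_line) auto
  finally have "(ennreal \<bar>moment k f x\<bar>)\<^sup>2 \<le> (\<integral>\<^sup>+t\<in>{0<..<x}. ennreal \<bar>t ^ k * f t\<bar> \<partial>half_line)\<^sup>2"
    by (rule power_mono_ennreal)
  then show ?thesis by (simp add: ennreal_power)
qed

lemma poly_op_eq_moments:
  assumes "0 < x"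
  shows "poly_op n a f x = (\<Sum>k\<le>n. a k x * moment k f x)"
proof -
  have "poly_op n a f x = (LINT t|lebesgue_on {0<..<x}. (\<Sum>k\<le>n. a k x * (t ^ k * f t)))"
    unfolding poly_op_def by (simp add: sum_distrib_right mult.assoc)
  also have "\<dots> = (\<Sum>k\<le>n. a k x * moment k f x)"
    unfolding moment_def using monomial_integrable[OF assms]
    by (subst Bochner_Integration.integral_sum) auto
  finally show ?thesis .
qed

text \<open>Beyond the support of \<open>f\<close> the moments no longer change, so for x > r the
  operator is a combination of the \<open>a k x\<close> with constant coefficients.\<close>

lemma op_bound_tail:
  assumes C: "op_bound C" and "0 < r" and supp: "\<And>t. r \<le> t \<Longrightarrow> f t = 0"
  shows "(\<integral>\<^sup>+x\<in>{r<..}. ennreal ((v x * (\<Sum>k\<le>n. a k x * moment k f r))\<^sup>2) \<partial>half_line) \<le> C * N f"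
proof -
  have "moment k f x = moment k f r" if "r < x" for k x
    using that \<open>0 < r\<close> supp unfolding moment_eq
    by (intro Bochner_Integration.integral_cong) (auto simp: indicator_def)
  then have "(\<integral>\<^sup>+x\<in>{r<..}. ennreal ((v x * (\<Sum>k\<le>n. a k x * moment k f r))\<^sup>2) \<partial>half_line)
    \<le> (\<integral>\<^sup>+x. ennreal ((v x * poly_op n a f x)\<^sup>2) \<partial>half_line)"
    using \<open>0 < r\<close> by (intro nn_integral_mono) (auto simp: indicator_def poly_op_eq_moments)
  then show ?thesis using C N_fin f_measurable unfolding op_bound_def by (meson order_trans)
qed

end

section \<open>Sufficiency: adding up Hardy inequalities\<close>

lemma op_bound_of_Muckenhoupt:
  fixes K :: ennreal
  assumes K: "\<And>k r. k \<le> n \<Longrightarrow> 0 < r \<Longrightarrow> V k {r<..} * U k r \<le> K"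
  shows "op_bound (of_nat (Suc n) * (of_nat (Suc n) * (16 * K)))"
  unfolding op_bound_def
proof (intro ballI impI)
  fix f assume f [measurable]: "f \<in> borel_measurable half_line" and fin: "N f < top"
  define G where "G k x = (\<integral>\<^sup>+t\<in>{0<..<x}. ennreal \<bar>t ^ k * f t\<bar> \<partial>half_line)" for k x
  have [measurable]: "G k \<in> borel_measurable half_line" for k
    unfolding G_def by (rule half_line_primitive_measurable) (rule monomial_less_top[OF f fin])
  have [measurable]: "(\<lambda>x. ennreal ((a k x * v x)\<^sup>2)) \<in> borel_measurable half_line" if "k \<in> {..n}" for k
    using a_measurable that by simp
  have "(\<integral>\<^sup>+x. ennreal ((v x * poly_op n a f x)\<^sup>2) \<partial>half_line)
    \<le> (\<integral>\<^sup>+x. of_nat (Suc n) * (\<Sum>k\<le>n. ennreal ((a k x * v x)\<^sup>2) * (G k x)\<^sup>2) \<partial>half_line)"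
  proof (rule nn_integral_mono)
    fix x assume "x \<in> space half_line"
    then have x: "0 < x" by simp
    have "(v x * poly_op n a f x)\<^sup>2 = (\<Sum>k\<le>n. (a k x * v x) * moment k f x)\<^sup>2"
      by (simp add: poly_op_eq_moments[OF f fin x] sum_distrib_left mult_ac)
    \<comment> \<open>Cauchy-Schwarz for \<open>n + 1\<close> summands gives one factor
      \<open>Suc n\<close>; adding \<open>n + 1\<close> equal Hardy bounds will give the
      other.\<close>
    also have "\<dots> \<le> (\<Sum>k\<le>n. ((a k x * v x) * moment k f x)\<^sup>2) * real (card {..n})"
      by (rule sum_squared_le_sum_of_squares)
    also have "\<dots> = real (Suc n) * (\<Sum>k\<le>n. (a k x * v x)\<^sup>2 * (moment k f x)\<^sup>2)"
      by (simp add: power_mult_distrib mult.commute)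
    finally have "ennreal ((v x * poly_op n a f x)\<^sup>2)
      \<le> ennreal (real (Suc n) * (\<Sum>k\<le>n. (a k x * v x)\<^sup>2 * (moment k f x)\<^sup>2))" by (rule ennreal_leI)
    also have "\<dots> = of_nat (Suc n) * (\<Sum>k\<le>n. ennreal ((a k x * v x)\<^sup>2) * ennreal ((moment k f x)\<^sup>2))"
      by (subst ennreal_mult) (auto simp: ennreal_mult[symmetric] sum_nonneg simp flip: ennreal_of_nat_eq_real_of_nat)
    also have "\<dots> \<le> of_nat (Suc n) * (\<Sum>k\<le>n. ennreal ((a k x * v x)\<^sup>2) * (G k x)\<^sup>2)"
      unfolding G_def by (intro mult_left_mono sum_mono moment_power2_le f fin x) auto
    finally show "ennreal ((v x * poly_op n a f x)\<^sup>2)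
      \<le> of_nat (Suc n) * (\<Sum>k\<le>n. ennreal ((a k x * v x)\<^sup>2) * (G k x)\<^sup>2)" .
  qed
  also have "\<dots> = of_nat (Suc n) * (\<Sum>k\<le>n. \<integral>\<^sup>+x. ennreal ((a k x * v x)\<^sup>2) * (G k x)\<^sup>2 \<partial>half_line)"
    by (simp add: nn_integral_cmult nn_integral_sum)
  also have "\<dots> \<le> of_nat (Suc n) * (\<Sum>k\<le>n. 16 * K * N f)"
  proof (intro mult_left_mono sum_mono)
    fix k assume k: "k \<in> {..n}"
    have [measurable]: "a k \<in> borel_measurable half_line" using a_measurable k by simp
    show "(\<integral>\<^sup>+x. ennreal ((a k x * v x)\<^sup>2) * (G k x)\<^sup>2 \<partial>half_line) \<le> 16 * K * N f"
      \<comment> \<open>Hardy's inequality is used with \<open>a k * v\<close> as outer weight and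
        with the factors \<open>t ^ k / u\<close> and \<open>u f\<close>, whose product is
        \<open>t ^ k * f\<close> almost everywhere.\<close>
      unfolding G_def monomial_nn_integral[OF f fin] N_def
    proof (rule weighted_Hardy_inequality)
      fix r :: real assume "0 < r"
      then show "(\<integral>\<^sup>+x\<in>{r<..}. ennreal ((a k x * v x)\<^sup>2) \<partial>half_line)
          * (\<integral>\<^sup>+x\<in>{0<..<r}. ennreal ((x ^ k * inverse (u x))\<^sup>2) \<partial>half_line) \<le> K"
        and "(\<integral>\<^sup>+x\<in>{0<..<r}. ennreal ((x ^ k * inverse (u x))\<^sup>2) \<partial>half_line) < \<infinity>"
        using K[of k r] U_less_top[of r k] k by (simp_all add: U_def V_def)
    next
      show "(\<integral>\<^sup>+x. ennreal ((u x * f x)\<^sup>2) \<partial>half_line) < \<infinity>" using fin by (simp add: N_def)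
    qed measurable
  qed auto
  also have "\<dots> = of_nat (Suc n) * (of_nat (Suc n) * (16 * K)) * N f" by (simp add: mult_ac)
  finally show "(\<integral>\<^sup>+x. ennreal ((v x * poly_op n a f x)\<^sup>2) \<partial>half_line)
    \<le> of_nat (Suc n) * (of_nat (Suc n) * (16 * K)) * N f" .
qed


section \<open>Necessity: test functions that are multiples of \<open>w\<close>\<close>

lemma measurable_tail_sum:
  "(\<lambda>x. ennreal ((v x * (\<Sum>k\<le>n. a k x * c k))\<^sup>2)) \<in> borel_measurable half_line"
proof -
  have [measurable]: "a k \<in> borel_measurable half_line" if "k \<in> {..n}" for k
    using a_measurable that by simp
  show ?thesis by measurable
qed

text \<open>The moments combine to the integral of a polynomial against \<open>w\<close> over
  (\<alpha>, \<beta>), which is a point value times the mass. In the application \<open>c\<close> is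
  the sequence of the \<open>a k x\<close>, so \<xi> depends on x.\<close>

lemma test_function_interpolation:
  fixes r \<alpha> \<beta> :: real
  assumes "0 \<le> \<alpha>" "\<alpha> < \<beta>" "\<beta> \<le> r"
  defines "f \<equiv> \<lambda>t. indicator {\<alpha><..<\<beta>} t * w t"
  shows "f \<in> borel_measurable half_line" "N f = \<mu> \<alpha> \<beta>"
    and "\<exists>\<xi>\<in>{\<alpha>..\<beta>}. (\<Sum>k\<le>n. c k * moment k f r) = (\<Sum>k\<le>n. c k * \<xi> ^ k) * enn2real (\<mu> \<alpha> \<beta>)"
proof -
  show f_meas [measurable]: "f \<in> borel_measurable half_line" unfolding f_def by measurable
  have "0 < r" using assms by simp
  have f_nonneg: "0 \<le> f t" for t using w_nonneg[of t] by (simp add: f_def)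
  have supp: "f t = 0" if "t \<notin> {\<alpha><..<\<beta>}" for t using that by (simp add: f_def)
  show Nf: "N f = \<mu> \<alpha> \<beta>"
    unfolding f_def N_times_w \<mu>_def by (intro nn_integral_cong) (simp add: indicator_def)
  have nn: "(\<integral>\<^sup>+t. ennreal (f t) \<partial>half_line) = \<mu> \<alpha> \<beta>"
    unfolding f_def \<mu>_def by (intro nn_integral_cong) (simp add: indicator_def)
  have int_f: "integrable half_line f"
    using nn \<mu>_less_top f_nonneg by (intro integrableI_nonneg) auto
  have LINT_f: "(LINT t|half_line. f t) = enn2real (\<mu> \<alpha> \<beta>)"
    using f_nonneg by (subst integral_eq_nn_integral) (auto simp: nn)
  have pos: "0 < (LINT t|half_line. f t)"
    using \<mu>_pos[OF assms(1,2)] \<mu>_less_top by (simp add: LINT_f enn2real_positive_iff)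
  have "N f < top" using Nf \<mu>_less_top by simp
  have int: "integrable half_line (\<lambda>t. indicator {0<..<r} t * (t ^ k * f t))" for k
    using monomial_integrable[OF f_meas \<open>N f < top\<close> \<open>0 < r\<close>] by (subst (asm) integral_lebesgue_on_half_line) auto
  have "(\<Sum>k\<le>n. c k * moment k f r) = (LINT t|half_line. (\<Sum>k\<le>n. c k * (indicator {0<..<r} t * (t ^ k * f t))))"
    unfolding moment_eq using int by (subst Bochner_Integration.integral_sum) auto
  also have "\<dots> = (LINT t|half_line. (\<Sum>k\<le>n. c k * t ^ k) * f t)"
  proof (intro Bochner_Integration.integral_cong refl)
    fix t
    have "indicator {0<..<r} t * (t ^ k * f t) = t ^ k * f t" for k
      using assms supp[of t] by (cases "t \<in> {\<alpha><..<\<beta>}") auto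
    then show "(\<Sum>k\<le>n. c k * (indicator {0<..<r} t * (t ^ k * f t))) = (\<Sum>k\<le>n. c k * t ^ k) * f t"
      by (simp only: sum_distrib_right mult.assoc)
  qed
  finally have eq: "(\<Sum>k\<le>n. c k * moment k f r) = (LINT t|half_line. (\<Sum>k\<le>n. c k * t ^ k) * f t)" .
  show "\<exists>\<xi>\<in>{\<alpha>..\<beta>}. (\<Sum>k\<le>n. c k * moment k f r) = (\<Sum>k\<le>n. c k * \<xi> ^ k) * enn2real (\<mu> \<alpha> \<beta>)"
    unfolding eq LINT_f[symmetric]
  proof (rule weighted_mean_value)
    show "continuous_on UNIV (\<lambda>t. \<Sum>k\<le>n. c k * t ^ k)" by (intro continuous_intros)
  qed (use int_f f_nonneg supp assms pos in auto)
qed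

text \<open>
  Testing the operator on \<open>w = 1 / u\<^sup>2\<close> restricted to \<open>n + 1\<close> separated subintervals of \<open>(0, r)\<close> yields,
  by the mean value theorem, the values of the polynomial \<open>\<Sum>k\<le>n. a k x * t ^ k\<close> at separated points,
  and these control its coefficients. Doubling makes the masses of the subintervals comparable to
  that of \<open>(0, r)\<close>, as long as their length \<open>r / (2 n + 2)\<close> is at least \<open>\<delta>\<close>.
\<close>

lemma Muckenhoupt_large:
  fixes \<delta> C D :: real
  assumes C: "op_bound (ennreal C)" "0 \<le> C" and "0 \<le> D"
    and doubling: "\<And>\<alpha> \<beta>. 0 \<le> \<alpha> \<Longrightarrow> \<alpha> < \<beta> \<Longrightarrow> \<delta> \<le> \<beta> - \<alpha> \<Longrightarrow>
      \<mu> \<alpha> \<beta> \<le> ennreal D * \<mu> ((3 * \<alpha> + \<beta>) / 4) ((\<alpha> + 3 * \<beta>) / 4)"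
  shows "\<exists>K<top. \<forall>k\<le>n. \<forall>r>0. 2 * real (Suc n) * \<delta> \<le> r \<longrightarrow> V k {r<..} * U k r \<le> K"
proof -
  \<comment> \<open>(0, r) is cut into 2 n + 2 cells of length \<eta> r and every other cell is
    used, so that points of different cells are at least \<eta> r apart.\<close>
  define \<eta> where "\<eta> = 1 / (2 * real (Suc n))"
  have \<eta>: "0 < \<eta>" by (simp add: \<eta>_def)
  obtain Kp where "0 \<le> Kp" and Kp: "\<forall>(p::real poly) M \<xi>. degree p \<le> n \<longrightarrow> (\<forall>i\<le>n. 0 \<le> \<xi> i \<and> \<xi> i \<le> 1) \<longrightarrow>
    (\<forall>i\<le>n. \<forall>j<i. \<eta> \<le> \<bar>\<xi> i - \<xi> j\<bar>) \<longrightarrow> (\<forall>i\<le>n. \<bar>poly p (\<xi> i)\<bar> \<le> M) \<longrightarrow>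
    (\<forall>k. \<bar>coeff p k\<bar> \<le> Kp * M)"
    using bounded_coefficients_of_interpolation[OF \<eta>, of n] by (elim exE conjE) (rule that)
  \<comment> \<open>\<open>E\<close> growth steps bring a cell of length \<eta> r beyond the length
    2 r, whatever r is.\<close>
  obtain E where "2 / \<eta> < (4/3 :: real) ^ E" using real_arch_pow[of "4/3" "2 / \<eta>"] by auto
  then have E: "2 < (4/3) ^ E * \<eta>" using \<eta> by (simp add: field_simps)
  \<comment> \<open>\<open>Kp\<close> squared and the first \<open>Suc n\<close> come from the
    squared interpolation bound; the second \<open>Suc n\<close> counts the tests, each contributing
    \<open>C\<close> times a ratio of masses, at most \<open>D ^ E\<close>.\<close>
  define K where "K = Kp\<^sup>2 * real (Suc n) * (real (Suc n) * (C * D ^ E))"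
  have "V k {r<..} * U k r \<le> ennreal K" if k: "k \<le> n" and "0 < r" and r: "2 * real (Suc n) * \<delta> \<le> r" for k r
  proof -
    define \<alpha> \<beta> where "\<alpha> i = 2 * real i * \<eta> * r" and "\<beta> i = (2 * real i + 1) * \<eta> * r" for i
    have len: "\<beta> i - \<alpha> i = \<eta> * r" for i by (simp add: \<alpha>_def \<beta>_def algebra_simps)
    have \<alpha>: "0 \<le> \<alpha> i" for i using \<eta> \<open>0 < r\<close> by (simp add: \<alpha>_def)
    have \<alpha>\<beta>: "\<alpha> i < \<beta> i" for i using len[of i] \<eta> \<open>0 < r\<close> mult_pos_pos[of \<eta> r] by linarith
    have \<beta>: "\<beta> i \<le> r" if "i \<le> n" for i
    proof -
      have "(2 * real i + 1) * \<eta> \<le> 1" using that by (simp add: \<eta>_def field_simps)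
      then show ?thesis unfolding \<beta>_def using \<open>0 < r\<close> mult_right_mono[of "(2 * real i + 1) * \<eta>" 1 r] by simp
    qed
    have \<delta>: "\<delta> \<le> \<beta> i - \<alpha> i" for i
      unfolding len using r by (simp add: \<eta>_def field_simps)
    define f where "f i = (\<lambda>t. indicator {\<alpha> i<..<\<beta> i} t * w t)" for i
    define m where "m i = enn2real (\<mu> (\<alpha> i) (\<beta> i))" for i
    define L where "L i x = (\<Sum>k\<le>n. a k x * moment k (f i) r)" for i x
    define m0 where "m0 = enn2real (\<mu> 0 r)"
    have m: "\<mu> (\<alpha> i) (\<beta> i) = ennreal (m i)" "0 < m i" for i
      using \<mu>_pos[OF \<alpha> \<alpha>\<beta>] \<mu>_less_top by (simp_all add: m_def enn2real_positive_iff)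
    have m0: "\<mu> 0 r = ennreal m0" "0 \<le> m0" using \<mu>_less_top by (simp_all add: m0_def)
    have m0_le: "m0 \<le> D ^ E * m i" if i: "i \<le> n" for i
    proof -
      have "\<mu> 0 r \<le> ennreal D ^ E * \<mu> (\<alpha> i) (\<beta> i)"
      proof (rule doubling_iterate[where m=\<mu> and \<delta>=\<delta> and \<alpha>="\<alpha> i" and \<beta>="\<beta> i", OF \<mu>_mono doubling \<open>0 < r\<close> \<alpha> \<alpha>\<beta> \<delta>])
        show "\<alpha> i = 0 \<or> \<alpha> i + \<beta> i \<le> 2 * r" using \<alpha>\<beta>[of i] \<beta>[OF i] by simp
        show "2 * r < (4/3) ^ E * (\<beta> i - \<alpha> i)"
          using mult_strict_right_mono[OF E \<open>0 < r\<close>] by (simp add: len mult.assoc)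
      qed auto
      then show ?thesis using \<open>0 \<le> D\<close> m[of i] m0 
        by (simp add: ennreal_power ennreal_mult'[symmetric] ennreal_le_iff less_imp_le)
    qed
    have point: "(a k x * v x)\<^sup>2 * r ^ (2 * k)
      \<le> Kp\<^sup>2 * real (Suc n) * (\<Sum>i\<le>n. (1 / (m i)\<^sup>2) * (v x * L i x)\<^sup>2)" for x
    proof -
      have "\<forall>i\<in>{..n}. \<exists>\<xi>\<in>{\<alpha> i..\<beta> i}. L i x = (\<Sum>k\<le>n. a k x * \<xi> ^ k) * m i"
        unfolding L_def m_def f_def
        by (intro ballI test_function_interpolation(3)[OF \<alpha> \<alpha>\<beta> \<beta>]) simp
      then obtain \<xi> where \<xi>: "\<And>i. i \<le> n \<Longrightarrow> \<xi> i \<in> {\<alpha> i..\<beta> i}"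
        "\<And>i. i \<le> n \<Longrightarrow> L i x = (\<Sum>k\<le>n. a k x * \<xi> i ^ k) * m i"
        by (metis atMost_iff)
      \<comment> \<open>The polynomial rescaled to the unit interval, where the interpolation bound
        applies. \<open>M\<close> is a sum and not a maximum, since its square is then bounded by a
        sum of squares that can be integrated over x.\<close>
      define q where "q = (\<Sum>k\<le>n. monom (a k x * r ^ k) k)"
      define M where "M = (\<Sum>i\<le>n. \<bar>L i x\<bar> / m i)"
      have q_poly: "poly q (\<xi> i / r) = L i x / m i" if "i \<le> n" for i
        using \<xi>(2)[OF that] m(2)[of i] \<open>0 < r\<close>
        by (simp add: q_def poly_sum poly_monom power_divide)
      have q_coeff: "coeff q k = a k x * r ^ k" using k by (simp add: q_def coeff_sum)
      have \<xi>_bounds: "2 * real i * \<eta> \<le> \<xi> i / r" "\<xi> i / r \<le> (2 * real i + 1) * \<eta>" if "i \<le> n" for i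
        using \<xi>(1)[OF that] \<open>0 < r\<close> by (simp_all add: \<alpha>_def \<beta>_def field_simps)
      have "\<bar>coeff q k\<bar> \<le> Kp * M"
      proof (rule Kp[rule_format, where \<xi>="\<lambda>i. \<xi> i / r"])
        show "degree q \<le> n" unfolding q_def
          by (intro degree_sum_le) (auto intro: order_trans[OF degree_monom_le])
        show "0 \<le> \<xi> i / r \<and> \<xi> i / r \<le> 1" if "i \<le> n" for i
          using \<xi>(1)[OF that] \<alpha>[of i] \<beta>[OF that] \<open>0 < r\<close> by simp
        show "\<eta> \<le> \<bar>\<xi> i / r - \<xi> j / r\<bar>" if "i \<le> n" "j < i" for i j
        proof -
          have "2 * real j + 2 \<le> 2 * real i" using that by simp
          then have "(2 * real j + 2) * \<eta> \<le> 2 * real i * \<eta>" using \<eta> by (intro mult_right_mono) auto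
          moreover have "j \<le> n" using that by simp
          ultimately show ?thesis using \<xi>_bounds[of i] \<xi>_bounds[of j] that by (simp add: algebra_simps)
        qed
        show "\<bar>poly q (\<xi> i / r)\<bar> \<le> M" if "i \<le> n" for i
          unfolding M_def q_poly[OF that] using that m(2)
          by (simp only: abs_divide abs_of_pos[OF m(2)], intro member_le_sum) (auto simp: less_imp_le)
      qed
      then have "\<bar>coeff q k\<bar>\<^sup>2 \<le> (Kp * M)\<^sup>2" by (rule power_mono) simp
      also have "\<dots> = Kp\<^sup>2 * M\<^sup>2" by (rule power_mult_distrib)
      also have "M\<^sup>2 \<le> (\<Sum>i\<le>n. (\<bar>L i x\<bar> / m i)\<^sup>2) * real (card {..n})"
        unfolding M_def by (rule sum_squared_le_sum_of_squares)
      finally have "(a k x * r ^ k)\<^sup>2 \<le> Kp\<^sup>2 * ((\<Sum>i\<le>n. (\<bar>L i x\<bar> / m i)\<^sup>2) * real (Suc n))"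
        by (simp add: q_coeff mult_left_mono)
      then have "(v x)\<^sup>2 * (a k x * r ^ k)\<^sup>2 \<le> (v x)\<^sup>2 * (Kp\<^sup>2 * ((\<Sum>i\<le>n. (\<bar>L i x\<bar> / m i)\<^sup>2) * real (Suc n)))"
        by (rule mult_left_mono) simp
      also have "\<dots> = Kp\<^sup>2 * real (Suc n) * (\<Sum>i\<le>n. (1 / (m i)\<^sup>2) * (v x * L i x)\<^sup>2)"
        by (simp add: sum_distrib_left power_divide power_mult_distrib mult_ac)
      also have "(v x)\<^sup>2 * (a k x * r ^ k)\<^sup>2 = (a k x * v x)\<^sup>2 * r ^ (2 * k)"
        by (simp add: power_mult_distrib power_mult[symmetric] mult_ac)
      finally show ?thesis .
    qed
    have L_meas [measurable]: "(\<lambda>x. ennreal ((v x * L i x)\<^sup>2)) \<in> borel_measurable half_line" for i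
      unfolding L_def by (rule measurable_tail_sum)
    have [measurable]: "a k \<in> borel_measurable half_line" using a_measurable k .
    have L_int: "(\<integral>\<^sup>+x\<in>{r<..}. ennreal ((v x * L i x)\<^sup>2) \<partial>half_line) \<le> ennreal (C * m i)" if "i \<le> n" for i
    proof -
      note f = test_function_interpolation(1,2)[OF \<alpha> \<alpha>\<beta> \<beta>[OF that], folded f_def]
      have "(\<integral>\<^sup>+x\<in>{r<..}. ennreal ((v x * L i x)\<^sup>2) \<partial>half_line) \<le> ennreal C * N (f i)"
        unfolding L_def
      proof (rule op_bound_tail[OF f(1) _ C(1) \<open>0 < r\<close>])
        show "N (f i) < top" using f(2) \<mu>_less_top by simp
        show "f i t = 0" if "r \<le> t" for t using that \<beta>[OF \<open>i \<le> n\<close>] by (simp add: f_def)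
      qed
      then show ?thesis using m[of i] C(2) by (simp add: f(2) ennreal_mult')
    qed
    have "V k {r<..} * ennreal (r ^ (2 * k))
      = (\<integral>\<^sup>+x\<in>{r<..}. ennreal ((a k x * v x)\<^sup>2 * r ^ (2 * k)) \<partial>half_line)"
      unfolding V_def using \<open>0 < r\<close>
      by (subst nn_integral_multc[symmetric]) (auto simp: ennreal_mult mult_ac)
    also have "\<dots> \<le> (\<integral>\<^sup>+x\<in>{r<..}. ennreal (Kp\<^sup>2 * real (Suc n) * (\<Sum>i\<le>n. (1 / (m i)\<^sup>2) * (v x * L i x)\<^sup>2)) \<partial>half_line)"
      by (intro nn_integral_mono mult_right_mono ennreal_leI point) auto
    also have "\<dots> = (\<integral>\<^sup>+x. ennreal (Kp\<^sup>2 * real (Suc n)) *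
        (\<Sum>i\<le>n. ennreal (1 / (m i)\<^sup>2) * (ennreal ((v x * L i x)\<^sup>2) * indicator {r<..} x)) \<partial>half_line)"
    proof (rule nn_integral_cong)
      fix x
      have "ennreal (Kp\<^sup>2 * real (Suc n) * (\<Sum>i\<le>n. (1 / (m i)\<^sup>2) * (v x * L i x)\<^sup>2))
        = ennreal (Kp\<^sup>2 * real (Suc n)) * (\<Sum>i\<le>n. ennreal (1 / (m i)\<^sup>2) * ennreal ((v x * L i x)\<^sup>2))"
        by (subst ennreal_mult, (auto intro!: sum_nonneg)[2], subst sum_ennreal[symmetric])
          (auto simp flip: ennreal_mult)
      then show "ennreal (Kp\<^sup>2 * real (Suc n) * (\<Sum>i\<le>n. (1 / (m i)\<^sup>2) * (v x * L i x)\<^sup>2)) * indicator {r<..} x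
        = ennreal (Kp\<^sup>2 * real (Suc n)) * (\<Sum>i\<le>n. ennreal (1 / (m i)\<^sup>2) * (ennreal ((v x * L i x)\<^sup>2) * indicator {r<..} x))"
        by (simp only: mult.assoc sum_distrib_right)
    qed
    also have "\<dots> = ennreal (Kp\<^sup>2 * real (Suc n)) *
        (\<Sum>i\<le>n. ennreal (1 / (m i)\<^sup>2) * (\<integral>\<^sup>+x\<in>{r<..}. ennreal ((v x * L i x)\<^sup>2) \<partial>half_line))"
      by (simp add: nn_integral_cmult nn_integral_sum)
    also have "\<dots> \<le> ennreal (Kp\<^sup>2 * real (Suc n)) * (\<Sum>i\<le>n. ennreal (1 / (m i)\<^sup>2) * ennreal (C * m i))"
      by (intro mult_left_mono sum_mono L_int) auto
    also have "\<dots> = ennreal (Kp\<^sup>2 * real (Suc n)) * (\<Sum>i\<le>n. ennreal (C / m i))"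
    proof -
      \<comment> \<open>The point value divides by \<open>m i\<close>, squared here, while the
        squared norm of the test function contributes \<open>m i\<close> once. The one power left is
        compared with the mass of (0, r).\<close>
      have "ennreal (1 / (m i)\<^sup>2) * ennreal (C * m i) = ennreal (C / m i)" for i
        using m(2)[of i] C(2) by (subst ennreal_mult[symmetric]) (auto simp: power2_eq_square)
      then show ?thesis by simp
    qed
    also have "\<dots> = ennreal (Kp\<^sup>2 * real (Suc n) * (\<Sum>i\<le>n. C / m i))"
      using C(2) m(2) by (subst sum_ennreal) (auto simp: ennreal_mult sum_nonneg less_imp_le)
    finally have V_le: "V k {r<..} * ennreal (r ^ (2 * k)) \<le> ennreal (Kp\<^sup>2 * real (Suc n) * (\<Sum>i\<le>n. C / m i))" .
    have "V k {r<..} * U k r \<le> V k {r<..} * (ennreal (r ^ (2 * k)) * \<mu> 0 r)"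
      by (intro mult_left_mono U_le \<open>0 < r\<close>) auto
    also have "\<dots> \<le> ennreal (Kp\<^sup>2 * real (Suc n) * (\<Sum>i\<le>n. C / m i)) * ennreal m0"
      unfolding m0(1) mult.assoc[symmetric] by (intro mult_right_mono V_le) auto
    also have "\<dots> = ennreal (Kp\<^sup>2 * real (Suc n) * (\<Sum>i\<le>n. C * (m0 / m i)))"
      using m0(2) by (subst ennreal_mult''[symmetric]) (auto simp: sum_distrib_right mult.assoc)
    also have "\<dots> \<le> ennreal K"
    proof -
      have "(\<Sum>i\<le>n. C * (m0 / m i)) \<le> (\<Sum>i\<le>n. C * D ^ E)"
        using m0_le m(2) C(2) by (intro sum_mono mult_left_mono) (auto simp: pos_divide_le_eq)
      then show ?thesis unfolding K_def by (intro ennreal_leI mult_left_mono) (auto simp: algebra_simps)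
    qed
    finally show ?thesis .
  qed
  then show ?thesis by (intro exI[of _ "ennreal K"]) auto
qed

text \<open>
  Only \<open>k = n\<close> is difficult, because \<open>a n\<close> is not assumed to be square integrable near \<open>0\<close>. The
  extremal function of the \<open>n\<close>-th condition serves as test function; the lower order terms are
  bounded by assumption and can be subtracted.
\<close>

lemma Muckenhoupt_small:
  fixes C R :: real
  assumes C: "op_bound (ennreal C)" "0 \<le> C" and "0 < R" and K: "K < top"
    and large: "\<And>k. k \<le> n \<Longrightarrow> V k {R<..} * U k R \<le> K"
    and fin: "\<And>k. k < n \<Longrightarrow> V k {0<..<2 * R} < top"
  shows "\<exists>K'<top. \<forall>k\<le>n. \<forall>r>0. r < R \<longrightarrow> V k {r<..} * U k r \<le> K'"
proof -
  define H where "H = (\<Sum>k<n. V k {0<..<2 * R} * U k R)"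
  \<comment> \<open>The 2 stems from the square of a difference, \<open>of_nat n\<close> from the
    square of a sum of n lower order terms, which \<open>H\<close> bounds uniformly in r <
    R.\<close>
  define K' where "K' = K + (2 * (ennreal C + of_nat n * H))"
  have "H < top"
    unfolding H_def using fin U_less_top[OF \<open>0 < R\<close>] by (simp add: ennreal_mult_less_top)
  then have "K' < top" using K by (simp add: K'_def ennreal_mult_less_top of_nat_less_top)
  moreover have "V k {r<..} * U k r \<le> K'" if k: "k \<le> n" and r: "0 < r" "r < R" for k r
  proof -
    have mid: "V k {r<..<2 * R} * U k r \<le> 2 * (ennreal C + of_nat n * H)"
    proof (cases "k < n")
      case True
      have "V k {r<..<2 * R} * U k r \<le> V k {0<..<2 * R} * U k R"
        using r by (intro mult_mono V_mono U_mono) auto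
      also have "\<dots> \<le> H" unfolding H_def using True by (intro member_le_sum) auto
      also have "\<dots> \<le> of_nat n * H" using True mult_right_mono[of 1 "of_nat n" H]
        by (cases n) auto
      also have "\<dots> \<le> 2 * (ennreal C + of_nat n * H)"
        using mult_right_mono[of 1 2 "ennreal C + of_nat n * H"] by (auto intro: order_trans[rotated])
      finally show ?thesis .
    next
      case False
      then have kn: "k = n" using k by simp
      \<comment> \<open>The case of equality in Cauchy-Schwarz for the moment of order n: both the
        squared norm and this moment are equal to \<open>U n r\<close>.\<close>
      define f where "f = (\<lambda>t. (indicator {0<..<r} t * t ^ n) * w t)"
      have f_meas: "f \<in> borel_measurable half_line" unfolding f_def by measurable
      have Nf: "N f = U n r"
        unfolding f_def N_times_w U_eq
        by (intro nn_integral_cong) (auto simp: indicator_def power_mult[symmetric] mult.commute)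
      define m where "m = enn2real (U n r)"
      have m: "U n r = ennreal m" "0 < m"
        using U_pos[OF r(1)] U_less_top[OF r(1)] by (simp_all add: m_def enn2real_positive_iff)
      have "moment n f r = m"
      proof -
        have "moment n f r = enn2real (\<integral>\<^sup>+t. ennreal (indicator {0<..<r} t * (t ^ n * f t)) \<partial>half_line)"
          unfolding moment_eq using f_meas w_nonneg
          by (intro integral_eq_nn_integral) (auto simp: f_def indicator_def intro!: mult_nonneg_nonneg)
        also have "(\<integral>\<^sup>+t. ennreal (indicator {0<..<r} t * (t ^ n * f t)) \<partial>half_line) = U n r"
          unfolding U_eq f_def
          by (intro nn_integral_cong) (auto simp: indicator_def mult_2 power_add mult.assoc)
        finally show ?thesis by (simp add: m_def)
      qed
      define L where "L x = (\<Sum>k\<le>n. a k x * moment k f r)" for x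
      have "N f < top" using Nf U_less_top[OF r(1)] by simp
      have L_int: "(\<integral>\<^sup>+x\<in>{r<..}. ennreal ((v x * L x)\<^sup>2) \<partial>half_line) \<le> ennreal C * ennreal m"
        using op_bound_tail[OF f_meas \<open>N f < top\<close> C(1) r(1)] unfolding L_def Nf m
        by (auto simp: f_def)
      have L_meas [measurable]: "(\<lambda>x. ennreal ((v x * L x)\<^sup>2)) \<in> borel_measurable half_line"
        unfolding L_def by (rule measurable_tail_sum)
      have a_meas [measurable]: "a n \<in> borel_measurable half_line" using a_measurable by simp
      have a_meas' [measurable]: "a j \<in> borel_measurable half_line" if "j \<in> {..<n}" for j
        using a_measurable that by simp
      \<comment> \<open>The squared lower moments carry one factor \<open>m\<close>, just like the
        bound for the operator; the top term will carry two.\<close>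
      have mom: "ennreal ((moment j f r)\<^sup>2) \<le> U j R * ennreal m" for j
      proof -
        have "ennreal ((moment j f r)\<^sup>2) \<le> U j r * N f"
          using moment_power2_le[OF f_meas \<open>N f < top\<close> r(1), of j]
            monomial_power2_le[OF f_meas \<open>N f < top\<close>, of j r] by (rule order_trans)
        also have "\<dots> \<le> U j R * ennreal m"
          unfolding Nf m using r by (intro mult_right_mono U_mono) auto
        finally show ?thesis .
      qed
      have point: "m\<^sup>2 * (a n x * v x)\<^sup>2
        \<le> 2 * ((v x * L x)\<^sup>2 + real n * (\<Sum>j<n. (a j x * v x)\<^sup>2 * (moment j f r)\<^sup>2))" for x
      proof -
        define B where "B = (\<Sum>j<n. (a j x * v x) * moment j f r)"
        have "v x * L x = B + (a n x * v x) * m"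
          unfolding L_def B_def lessThan_Suc_atMost[symmetric] \<open>moment n f r = m\<close>[symmetric]
          by (simp add: sum_distrib_left distrib_left mult_ac)
        then have "m * (a n x * v x) = v x * L x - B" by simp
        then have "m\<^sup>2 * (a n x * v x)\<^sup>2 = (v x * L x - B)\<^sup>2" by (metis power_mult_distrib)
        also have "\<dots> \<le> 2 * ((v x * L x)\<^sup>2 + B\<^sup>2)"
          using sum_squares_bound[of "v x * L x" "-B"] by (simp add: power2_eq_square algebra_simps)
        also have "B\<^sup>2 \<le> (\<Sum>j<n. ((a j x * v x) * moment j f r)\<^sup>2) * real (card {..<n})"
          unfolding B_def by (rule sum_squared_le_sum_of_squares)
        finally show ?thesis by (simp add: power_mult_distrib mult.commute)
      qed
      let ?I = "indicator {r<..<2 * R} :: real \<Rightarrow> ennreal"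
      have "ennreal (m\<^sup>2) * V n {r<..<2 * R} = (\<integral>\<^sup>+x\<in>{r<..<2 * R}. ennreal (m\<^sup>2 * (a n x * v x)\<^sup>2) \<partial>half_line)"
        unfolding V_def by (subst nn_integral_cmult[symmetric]) (auto simp: ennreal_mult mult_ac)
      also have "\<dots> \<le> (\<integral>\<^sup>+x\<in>{r<..<2 * R}.
          ennreal (2 * ((v x * L x)\<^sup>2 + real n * (\<Sum>j<n. (a j x * v x)\<^sup>2 * (moment j f r)\<^sup>2))) \<partial>half_line)"
        by (intro nn_integral_mono mult_right_mono ennreal_leI point) auto
      also have "\<dots> = (\<integral>\<^sup>+x. 2 * (ennreal ((v x * L x)\<^sup>2) * ?I x
          + of_nat n * (\<Sum>j<n. ennreal ((a j x * v x)\<^sup>2) * ?I x * ennreal ((moment j f r)\<^sup>2))) \<partial>half_line)"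
      proof (rule nn_integral_cong)
        fix x
        have "ennreal (2 * ((v x * L x)\<^sup>2 + real n * (\<Sum>j<n. (a j x * v x)\<^sup>2 * (moment j f r)\<^sup>2)))
          = 2 * (ennreal ((v x * L x)\<^sup>2) + of_nat n * (\<Sum>j<n. ennreal ((a j x * v x)\<^sup>2) * ennreal ((moment j f r)\<^sup>2)))"
          by (simp add: ennreal_mult sum_nonneg ennreal_of_nat_eq_real_of_nat sum_ennreal[symmetric])
        then show "ennreal (2 * ((v x * L x)\<^sup>2 + real n * (\<Sum>j<n. (a j x * v x)\<^sup>2 * (moment j f r)\<^sup>2))) * ?I x
          = 2 * (ennreal ((v x * L x)\<^sup>2) * ?I x
          + of_nat n * (\<Sum>j<n. ennreal ((a j x * v x)\<^sup>2) * ?I x * ennreal ((moment j f r)\<^sup>2)))"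
          by (simp add: indicator_def)
      qed
      also have "\<dots> = 2 * ((\<integral>\<^sup>+x\<in>{r<..<2 * R}. ennreal ((v x * L x)\<^sup>2) \<partial>half_line)
          + of_nat n * (\<Sum>j<n. V j {r<..<2 * R} * ennreal ((moment j f r)\<^sup>2)))"
        unfolding V_def by (simp add: nn_integral_cmult nn_integral_add nn_integral_sum nn_integral_multc)
      also have "\<dots> \<le> 2 * (ennreal C * ennreal m + of_nat n * (\<Sum>j<n. V j {0<..<2 * R} * (U j R * ennreal m)))"
      proof (intro mult_left_mono add_mono sum_mono mult_mono V_mono mom)
        have "(\<integral>\<^sup>+x\<in>{r<..<2 * R}. ennreal ((v x * L x)\<^sup>2) \<partial>half_line)
          \<le> (\<integral>\<^sup>+x\<in>{r<..}. ennreal ((v x * L x)\<^sup>2) \<partial>half_line)"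
          by (intro set_nn_integral_subset) auto
        with L_int show "(\<integral>\<^sup>+x\<in>{r<..<2 * R}. ennreal ((v x * L x)\<^sup>2) \<partial>half_line) \<le> ennreal C * ennreal m"
          by simp
      qed (use r in auto)
      also have "\<dots> = ennreal m * (2 * (ennreal C + of_nat n * H))"
        by (simp add: H_def sum_distrib_left sum_distrib_right distrib_left mult_ac)
      finally have "ennreal m * (ennreal m * V n {r<..<2 * R}) \<le> ennreal m * (2 * (ennreal C + of_nat n * H))"
        using m by (simp add: power2_eq_square ennreal_mult mult.assoc)
      \<comment> \<open>One factor \<open>m\<close> cancels, being positive and finite; the other
        one is the \<open>U n r\<close> of the desired product.\<close>
      then have "ennreal m * V n {r<..<2 * R} \<le> 2 * (ennreal C + of_nat n * H)"
        using m by (subst (asm) ennreal_mult_le_mult_iff) auto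
      then show ?thesis by (simp add: kn m mult.commute)
    qed
    \<comment> \<open>The middle piece extends to 2 R so that the two pieces also cover the point
      R.\<close>
    have "V k {r<..} * U k r \<le> V k ({R<..} \<union> {r<..<2 * R}) * U k r"
      using \<open>0 < R\<close> by (intro mult_right_mono V_mono) auto
    also have "\<dots> \<le> (V k {R<..} + V k {r<..<2 * R}) * U k r"
      by (intro mult_right_mono V_Un k) auto
    also have "\<dots> \<le> V k {R<..} * U k R + V k {r<..<2 * R} * U k r"
      unfolding distrib_right using r by (intro add_right_mono mult_left_mono U_mono) auto
    also have "\<dots> \<le> K'" unfolding K'_def by (intro add_mono large k mid)
    finally show ?thesis .
  qed
  ultimately show ?thesis by blast
qed

section \<open>Translation between squared integrals and norms\<close>

lemma V_eq_L2norm: "E \<in> sets borel \<Longrightarrow> E \<subseteq> {0<..} \<Longrightarrow> V k E = (L2norm E (\<lambda>x. a k x * v x))\<^sup>2"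
  unfolding L2norm_power2 V_def by (subst nn_integral_lebesgue_on_half_line[where E=E]) auto

lemma U_eq_L2norm: "U k r = (L2norm {0<..<r} (\<lambda>x. x ^ k * inverse (u x)))\<^sup>2"
  unfolding L2norm_power2 U_def by (subst nn_integral_lebesgue_on_half_line[where E="{0<..<r}"]) auto

text \<open>Squaring preserves and reflects the order of extended nonnegative reals and turns the
  product of norms in \<open>S\<close> into \<open>V k {r<..} * U k r\<close>; a bound K for the
  latter becomes the bound sqrt K.\<close>

lemma S_less_top_iff: "S a u v k < top \<longleftrightarrow> (\<exists>K<top. \<forall>r>0. V k {r<..} * U k r \<le> K)"
proof
  assume "S a u v k < top"
  then have "(S a u v k)\<^sup>2 < top" by (simp add: ennreal_power2_less_top_iff)
  moreover have "V k {r<..} * U k r \<le> (S a u v k)\<^sup>2" if "0 < r" for r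
    using that unfolding S_def
    by (subst V_eq_L2norm) (auto simp: U_eq_L2norm power_mult_distrib[symmetric] ennreal_power2_le_iff intro!: SUP_upper)
  ultimately show "\<exists>K<top. \<forall>r>0. V k {r<..} * U k r \<le> K" by blast
next
  assume "\<exists>K<top. \<forall>r>0. V k {r<..} * U k r \<le> K"
  then obtain K where "K < top" and K: "\<And>r. 0 < r \<Longrightarrow> V k {r<..} * U k r \<le> K" by blast
  then obtain \<kappa> where \<kappa>: "K = ennreal \<kappa>" "0 \<le> \<kappa>" by (cases K) auto
  have "L2norm {r<..} (\<lambda>x. a k x * v x) * L2norm {0<..<r} (\<lambda>x. x ^ k * inverse (u x)) \<le> ennreal (sqrt \<kappa>)"
    if "0 < r" for r
  proof (subst ennreal_power2_le_iff[symmetric])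
    have "(L2norm {r<..} (\<lambda>x. a k x * v x))\<^sup>2 * (L2norm {0<..<r} (\<lambda>x. x ^ k * inverse (u x)))\<^sup>2 \<le> K"
      using K[OF that] that by (subst (asm) V_eq_L2norm) (auto simp: U_eq_L2norm)
    then show "(L2norm {r<..} (\<lambda>x. a k x * v x) * L2norm {0<..<r} (\<lambda>x. x ^ k * inverse (u x)))\<^sup>2 \<le> (ennreal (sqrt \<kappa>))\<^sup>2"
      using \<kappa> by (simp add: power_mult_distrib ennreal_power)
  qed
  then have "S a u v k \<le> ennreal (sqrt \<kappa>)" unfolding S_def by (intro SUP_least) auto
  then show "S a u v k < top" by (auto intro: le_less_trans)
qed

lemma op_bound_iff_L2norm:
  assumes "0 \<le> C"
  shows "op_bound (ennreal (C\<^sup>2)) \<longleftrightarrow> (\<forall>f. f \<in> borel_measurable half_line \<and> L2norm {0<..} (\<lambda>x. u x * f x) < \<infinity>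
    \<longrightarrow> L2norm {0<..} (\<lambda>x. v x * poly_op n a f x) \<le> ennreal C * L2norm {0<..} (\<lambda>x. u x * f x))"
proof -
  have N: "N f = (L2norm {0<..} (\<lambda>x. u x * f x))\<^sup>2" for f by (simp add: N_def L2norm_power2)
  have "(\<integral>\<^sup>+x. ennreal ((v x * poly_op n a f x)\<^sup>2) \<partial>half_line) \<le> ennreal (C\<^sup>2) * N f
    \<longleftrightarrow> L2norm {0<..} (\<lambda>x. v x * poly_op n a f x) \<le> ennreal C * L2norm {0<..} (\<lambda>x. u x * f x)" for f
    unfolding N L2norm_power2[symmetric] using assms
    by (simp add: ennreal_power[symmetric] power_mult_distrib[symmetric] ennreal_power2_le_iff)
  then show ?thesis unfolding op_bound_def by (auto simp: N ennreal_power2_less_top_iff)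
qed

end

theorem theorem1p1:
  fixes n :: nat and u v :: "real \<Rightarrow> real" and a :: "nat \<Rightarrow> real \<Rightarrow> real" and \<delta> :: real
  assumes "weight u" and "weight v"
    and "\<And>k. k \<le> n \<Longrightarrow> a k \<in> borel_measurable (lebesgue_on {0<..})"
    and "0 \<le> \<delta>"
    and "(\<lambda>x. inverse ((u x)\<^sup>2)) \<in> B \<delta>"
    and "0 < \<delta> \<Longrightarrow> \<forall>r>0. \<forall>k<n. L2norm {0<..<r} (\<lambda>x. a k x * v x) < \<infinity>"
  shows "(\<exists>C::real. 0 < C \<and>
            (\<forall>f. f \<in> borel_measurable (lebesgue_on {0<..}) \<and>
                 L2norm {0<..} (\<lambda>x. u x * f x) < \<infinity> \<longrightarrow>
               L2norm {0<..} (\<lambda>x. v x * poly_op n a f x)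
               \<le> ennreal C * L2norm {0<..} (\<lambda>x. u x * f x)))
         \<longleftrightarrow> (\<forall>k\<le>n. S a u v k < \<infinity>)"
proof -
  let ?w = "\<lambda>x. inverse ((u x)\<^sup>2)"
  have [measurable]: "u \<in> borel_measurable half_line" "v \<in> borel_measurable half_line"
    and u_nonneg: "\<And>x. 0 < x \<Longrightarrow> 0 \<le> u x"
    using assms(1,2) by (auto simp: weight_def)
  have AE_w: "AE x in half_line. 0 < ?w x"
    and integrable_w: "\<And>K. compact K \<Longrightarrow> K \<subseteq> {0<..} \<Longrightarrow> integrable (lebesgue_on K) ?w"
    using assms(5) by (auto simp: B_def)
  obtain D0 :: real where D0: "\<And>\<alpha> \<beta>. 0 \<le> \<alpha> \<Longrightarrow> \<alpha> < \<beta> \<Longrightarrow> \<delta> \<le> \<beta> - \<alpha> \<Longrightarrow>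
      (\<integral>\<^sup>+x. ennreal (?w x) \<partial>lebesgue_on {\<alpha><..<\<beta>})
      \<le> ennreal D0 * (\<integral>\<^sup>+x. ennreal (?w x) \<partial>lebesgue_on {(3 * \<alpha> + \<beta>) / 4<..<(\<alpha> + 3 * \<beta>) / 4})"
    using assms(5) unfolding B_def by blast
  have doubling: "(\<integral>\<^sup>+x\<in>{\<alpha><..<\<beta>}. ennreal (?w x) \<partial>half_line)
      \<le> ennreal (max 0 D0) * (\<integral>\<^sup>+x\<in>{(3 * \<alpha> + \<beta>) / 4<..<(\<alpha> + 3 * \<beta>) / 4}. ennreal (?w x) \<partial>half_line)"
    if "0 \<le> \<alpha>" "\<alpha> < \<beta>" "\<delta> \<le> \<beta> - \<alpha>" for \<alpha> \<beta>
  proof -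
    have eq: "(\<integral>\<^sup>+x. ennreal (?w x) \<partial>lebesgue_on {s<..<t}) = (\<integral>\<^sup>+x\<in>{s<..<t}. ennreal (?w x) \<partial>half_line)"
      if "0 \<le> s" for s t
      by (rule nn_integral_lebesgue_on_half_line) (use that in auto)
    \<comment> \<open>\<open>ennreal\<close> sends negative reals to 0, so the doubling constant may
      be taken nonnegative.\<close>
    have "ennreal (max 0 D0) = ennreal D0" by (simp add: ennreal_neg max_def)
    then show ?thesis using D0[OF that] that by (simp only: eq) (simp add: eq)
  qed
  interpret weighted_polynomial_operator n u v a
  proof
    show "AE x in half_line. 0 < u x"
    proof -
      have "AE x in half_line. 0 < x" by (rule AE_I2) simp
      with AE_w show ?thesis
        by eventually_elim (use u_nonneg in \<open>force simp: less_le\<close>)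
    qed
    fix r :: real assume "0 < r"
    \<comment> \<open>Long enough for doubling on (0, R); the concentric half lies in the compact
      interval [R/4, 3R/4].\<close>
    define R where "R = max r (\<delta> + 1)"
    have "0 < R" "\<delta> \<le> R" using \<open>0 < r\<close> by (auto simp: R_def)
    have "(\<integral>\<^sup>+x\<in>{0<..<r}. ennreal (?w x) \<partial>half_line) \<le> (\<integral>\<^sup>+x\<in>{0<..<R}. ennreal (?w x) \<partial>half_line)"
      by (intro set_nn_integral_subset) (auto simp: R_def)
    also have "\<dots> \<le> ennreal (max 0 D0) * (\<integral>\<^sup>+x\<in>{(3 * 0 + R) / 4<..<(0 + 3 * R) / 4}. ennreal (?w x) \<partial>half_line)"
      using \<open>0 < R\<close> \<open>\<delta> \<le> R\<close> by (intro doubling) auto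
    also have "\<dots> \<le> ennreal (max 0 D0) * (\<integral>\<^sup>+x\<in>{R / 4..3 * R / 4}. ennreal (?w x) \<partial>half_line)"
      by (intro mult_left_mono set_nn_integral_subset) auto
    also have "(\<integral>\<^sup>+x\<in>{R / 4..3 * R / 4}. ennreal (?w x) \<partial>half_line)
      = (\<integral>\<^sup>+x. ennreal (?w x) \<partial>lebesgue_on {R / 4..3 * R / 4})"
      using \<open>0 < R\<close> by (intro nn_integral_lebesgue_on_half_line[symmetric]) auto
    also have "ennreal (max 0 D0) * \<dots> < top"
    proof -
      have "integrable (lebesgue_on {R / 4..3 * R / 4}) ?w"
        using \<open>0 < R\<close> by (intro integrable_w) auto
      then have "(\<integral>\<^sup>+x. ennreal (?w x) \<partial>lebesgue_on {R / 4..3 * R / 4}) < top"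
        by (subst nn_integral_eq_integral) auto
      then show ?thesis by (simp add: ennreal_mult_less_top)
    qed
    finally show "(\<integral>\<^sup>+x\<in>{0<..<r}. ennreal (?w x) \<partial>half_line) < top" .
  qed (use assms(3) in simp_all)
  have Muckenhoupt: "\<exists>K<top. \<forall>k\<le>n. \<forall>r>0. V k {r<..} * U k r \<le> K" if C: "op_bound (ennreal C)" "0 \<le> C" for C
  proof -
    \<comment> \<open>At r = R the cells have length exactly \<delta>, the least length for which
      doubling is available.\<close>
    define R where "R = 2 * real (Suc n) * \<delta>"
    have dbl: "\<mu> \<alpha> \<beta> \<le> ennreal (max 0 D0) * \<mu> ((3 * \<alpha> + \<beta>) / 4) ((\<alpha> + 3 * \<beta>) / 4)"
      if "0 \<le> \<alpha>" "\<alpha> < \<beta>" "\<delta> \<le> \<beta> - \<alpha>" for \<alpha> \<beta>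
      unfolding \<mu>_def w_def by (rule doubling[OF that])
    have "\<exists>K<top. \<forall>k\<le>n. \<forall>r>0. R \<le> r \<longrightarrow> V k {r<..} * U k r \<le> K"
      unfolding R_def by (rule Muckenhoupt_large[OF C _ dbl]) auto
    then obtain K where K: "K < top" "\<And>k r. k \<le> n \<Longrightarrow> 0 < r \<Longrightarrow> R \<le> r \<Longrightarrow> V k {r<..} * U k r \<le> K"
      by blast
    show ?thesis
    proof (cases "0 < \<delta>")
      case True
      then have "0 < R" by (simp add: R_def)
      have fin: "V k {0<..<2 * R} < top" if "k < n" for k
        using assms(6)[OF True] that \<open>0 < R\<close>
        by (subst V_eq_L2norm) (auto simp: ennreal_power2_less_top_iff)
      have "\<exists>K'<top. \<forall>k\<le>n. \<forall>r>0. r < R \<longrightarrow> V k {r<..} * U k r \<le> K'"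
        by (rule Muckenhoupt_small[OF C \<open>0 < R\<close> K(1) K(2) fin]) (use \<open>0 < R\<close> in auto)
      then obtain K' where K': "K' < top" "\<And>k r. k \<le> n \<Longrightarrow> 0 < r \<Longrightarrow> r < R \<Longrightarrow> V k {r<..} * U k r \<le> K'"
        by blast
      have "V k {r<..} * U k r \<le> max K K'" if "k \<le> n" "0 < r" for k r
        using K(2)[OF that] K'(2)[OF that] by (cases "r < R") (auto intro: max.coboundedI1 max.coboundedI2)
      then show ?thesis using K(1) K'(1) by (intro exI[of _ "max K K'"]) auto
    next
      case False
      then have "R = 0" using assms(4) by (simp add: R_def)
      then show ?thesis using K by (intro exI[of _ K]) auto
    qed
  qed
  show ?thesis
  proof
    assume "\<exists>C::real. 0 < C \<and>
            (\<forall>f. f \<in> borel_measurable (lebesgue_on {0<..}) \<and>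
                 L2norm {0<..} (\<lambda>x. u x * f x) < \<infinity> \<longrightarrow>
               L2norm {0<..} (\<lambda>x. v x * poly_op n a f x)
               \<le> ennreal C * L2norm {0<..} (\<lambda>x. u x * f x))"
    then obtain C where "0 < C" "op_bound (ennreal (C\<^sup>2))"
      using op_bound_iff_L2norm by (metis less_imp_le)
    then obtain K where "K < top" "\<And>k r. k \<le> n \<Longrightarrow> 0 < r \<Longrightarrow> V k {r<..} * U k r \<le> K"
      using Muckenhoupt[of "C\<^sup>2"] by auto
    then show "\<forall>k\<le>n. S a u v k < \<infinity>"
      using S_less_top_iff by (metis infinity_ennreal_def)
  next
    assume "\<forall>k\<le>n. S a u v k < \<infinity>"
    then have "\<forall>k\<in>{..n}. \<exists>K<top. \<forall>r>0. V k {r<..} * U k r \<le> K"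
      using S_less_top_iff by simp
    then obtain K where K: "\<And>k. k \<le> n \<Longrightarrow> K k < top"
      "\<And>k r. k \<le> n \<Longrightarrow> 0 < r \<Longrightarrow> V k {r<..} * U k r \<le> K k"
      by (metis atMost_iff)
    have "V k {r<..} * U k r \<le> (\<Sum>k\<le>n. K k)" if "k \<le> n" "0 < r" for k r
      using K(2)[OF that] member_le_sum[of k "{..n}" K] that by (auto intro: order_trans)
    then have bound: "op_bound (of_nat (Suc n) * (of_nat (Suc n) * (16 * (\<Sum>k\<le>n. K k))))" (is "op_bound ?C")
      by (rule op_bound_of_Muckenhoupt)
    have "?C < top" using K(1) by (simp add: ennreal_mult_less_top of_nat_less_top del: of_nat_Suc)
    then obtain c where c: "?C = ennreal c" "0 \<le> c" by (cases ?C) auto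
    \<comment> \<open>Adding 1 keeps the operator constant positive even if the bound is 0.\<close>
    have "?C \<le> ennreal ((sqrt (c + 1))\<^sup>2)" using c by (simp add: ennreal_leI)
    then have "op_bound (ennreal ((sqrt (c + 1))\<^sup>2))"
      using bound unfolding op_bound_def by (meson mult_right_mono order_trans zero_le)
    then show "\<exists>C::real. 0 < C \<and>
            (\<forall>f. f \<in> borel_measurable (lebesgue_on {0<..}) \<and>
                 L2norm {0<..} (\<lambda>x. u x * f x) < \<infinity> \<longrightarrow>
               L2norm {0<..} (\<lambda>x. v x * poly_op n a f x)
               \<le> ennreal C * L2norm {0<..} (\<lambda>x. u x * f x))"
      using op_bound_iff_L2norm[of "sqrt (c + 1)"] c(2) by (intro exI[of _ "sqrt (c + 1)"]) auto
  qed
qed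

end
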